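(* Let $\mathbb F_q$ be a finite field of characteristic $p$ with $q=p^s$ elements, let $n\ge2$, let $b\in\mathbb F_q^*$ and let $k,k_1,\dots,k_n,m_1,\dots,m_n$ be positive integers. Let $N_q$ be the number of solutions $(x_1,\dots,x_n)\in\mathbb F_q^n$ of $$(x_1^{m_1}+\dots+x_n^{m_n})^k=bx_1^{k_1}\cdots x_n^{k_n}.$$ Let $d_j=\gcd(m_j,q-1)$, $D=\mathrm{lcm}[d_1,\dots,d_n]$, $M=\mathrm{lcm}[m_1,\dots,m_n]$ and $k_0=\gcd(k,k_1,\dots,k_n,q-1)$. Assume that $b$ is a $k_0$th power in $\mathbb F_q$, that $D>2$, that there exists a positive integer $\ell$ with $D\mid p^\ell+1$ (let $\ell$ be the minimal such integer), and that $$\gcd\Bigl(\sum_{j=1}^n\frac{k_jM}{k_0m_j}-\frac{kM}{k_0},\ \frac{k_1(q-1)}{k_0d_1},\dots,\frac{k_n(q-1)}{k_0d_n},\ \frac{q-1}{k_0}\Bigr)=1.$$ Then $2\ell\mid s$ and $$N_q=q^{n-1}-(-1)^n+\frac{(k_0-1)((q-1)^n-(-1)^n)}{q}-(-1)^{((s/2\ell)-1)n}k_0q^{(n-2)/2}I(d_1,\dots,d_n)-(-1)^n(k_0+q-1)\sum_{r=2}^{n-1}(-1)^{rs/2\ell}q^{(r-2)/2}\sum_{1\le j_1<\dots<j_r\le n}I(d_{j_1},\dots,d_{j_r}).$$ In particular, if $d_1=\dots=d_n=D$, then $$N_q=q^{n-1}-(-1)^n+\frac{(k_0-1)((q-1)^n-(-1)^n)}{q}-(-1)^{((s/2\ell)-1)n}k_0q^{(n-2)/2}\frac{(D-1)^n+(-1)^n(D-1)}{D}-(-1)^n(k_0+q-1)\sum_{r=2}^{n-1}(-1)^{rs/2\ell}q^{(r-2)/2}\binom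 nr\frac{(D-1)^r+(-1)^r(D-1)}{D}.$$
   Context: For positive integers $v_1,\dots,v_r$, $I(v_1,\dots,v_r)$ denotes the number of $r$-tuples $(j_1,\dots,j_r)$ of integers with $1\le j_i\le v_i-1$ for all $i$ such that $j_1/v_1+\dots+j_r/v_r$ is an integer. *)

theory Defs
  imports Complex_Main "HOL-Computational_Algebra.Primes" "HOL-Library.FuncSet"
begin

definition Icount :: "(nat \<Rightarrow> nat) \<Rightarrow> nat set \<Rightarrow> nat" where
  "Icount v J = card {t \<in> PiE J (\<lambda>i. {1..v i - 1}).
      (\<Sum>i\<in>J. of_nat (t i) / of_nat (v i) :: rat) \<in> \<int>}"

end

theory Submission
  imports Defs "HOL-Computational_Algebra.Polynomial" "HOL-Number_Theory.Number_Theory"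
    "HOL-Library.Cardinality"
begin

text \<open>
  Write $S(x) = \sum_j x_j^{m_j}$. A solution with a vanishing coordinate is a zero of $S$ with a
  vanishing coordinate. On the points with nonzero coordinates and $S(x) \neq 0$ the
  value $\Phi(x) = b \prod_j x_j^{k_j} / S(x)^k$ is a $k_0$-th power, and the substitutions
  $x_j \mapsto t^{M/m_j} x_j$ and $x_i \mapsto t^{(q-1)/d_i} x_i$ multiply $\Phi$ by powers of
  $t^{k_0}$ whose exponents are coprime by the gcd condition; hence all fibres of $\Phi$ over the
  group of $k_0$-th powers have the same size, and only zeros of $S$ remain to be counted.

  This is done with an additive character $\psi$. For $Q = p^\ell$ the sum
  $W(a) = \sum_x \psi(a x^{Q+1})$ is a Hermitian Gauss sum: $W(a)^2$ is $q$ times the size of the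
  kernel of $u \mapsto a u + a^Q u^{Q^2}$, and the sign of $W(a)$ follows from
  $W(a) \equiv 1 \pmod{Q+1}$. Averaging gives the sums with $Q+1$ replaced by a divisor $d$. If
  $h^{Q-1} = -1$, then $\sum_x \psi(h a x^d)$ depends only on whether $a$ is a $d$-th power, with
  the same twist $h$ for all $d$, so no character signs have to be tracked; products of
  such sums over the coordinates are expressed through the numbers $I$ by expanding in roots of unity.
\<close>

section \<open>Power residues in finite fields\<close>

text \<open>The semiprimitive hypothesis makes all the Gauss sums involved rational. It does so here
  because \<open>x ^ (Q + 1)\<close> is \<open>x * x ^ Q\<close>, a product of two additive
  functions, so the square of such a sum is governed by an additive kernel. The sum
  \<open>W a\<close> is exceptional exactly when some \<open>u\<close> satisfies
  \<open>(a * u ^ (Q + 1)) ^ (Q - 1) = -1\<close>, and these \<open>a\<close> form a single coset of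
  the \<open>(Q + 1)\<close>-th powers. In odd characteristic the parity of
  \<open>(q - 1) / (Q ^ 2 - 1)\<close> decides whether this is the trivial coset, which would
  normally force a case distinction. Multiplication by \<open>h\<close> turns the -1 into 1, so the
  exceptional coset becomes the powers themselves. As \<open>h\<close> depends on \<open>Q\<close>
  alone, one substitution \<open>a\<close> to \<open>h * a\<close> in the outer sum over additive
  characters treats all coordinates at once. Two counts of zeros are needed, over all points and
  over points without a vanishing coordinate. The second is the source of the sum over
  \<open>r\<close>: dropping \<open>x = 0\<close> subtracts 1 from each factor, and the product then
  expands over subsets of coordinates.\<close>

lemma field_type_ring:
  "field (\<lparr>carrier = UNIV, monoid.mult = (*), one = 1, ring.zero = 0, add = (+)\<rparr> :: ('a::field) ring)"
  (is "field ?R")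
proof -
  have "\<exists>y. x + y = 0" for x :: 'a
    using add.right_inverse by blast
  moreover have "x \<noteq> 0 \<Longrightarrow> \<exists>y. x * y = 1" for x :: 'a
    by (rule exI[of _ "inverse x"]) auto
  ultimately show ?thesis
    by unfold_locales (auto simp: algebra_simps Units_def)
qed

lemma card_units_pos: "card (UNIV :: 'a::finite_field set) - 1 > 0"
proof -
  have "card {0, 1::'a} \<le> CARD('a)" by (intro card_mono) auto
  then show ?thesis by simp
qed

lemma card_nonzero: "card (- {0 :: 'a::finite_field}) = CARD('a) - 1"
  by (simp add: Compl_eq_Diff_UNIV card_Diff_subset)

lemma power_card_minus_1:
  fixes x :: "'a::finite_field"
  assumes "x \<noteq> 0"
  shows "x ^ (CARD('a) - 1) = 1"
proof -
  have "Suc (CARD('a) - 1) = CARD('a)" using card_units_pos[where ?'a='a] by simp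
  then have "x * x ^ (CARD('a) - 1) = x ^ CARD('a)" by (metis power_Suc)
  also have "\<dots> = x * 1" by (simp add: finite_field_power_card_eq_same)
  finally show ?thesis using assms mult_cancel_left by blast
qed

lemma power_mod_card:
  fixes x :: "'a::finite_field"
  assumes "x \<noteq> 0"
  shows "x ^ (i mod (CARD('a) - 1)) = x ^ i"
proof -
  have "x ^ i = x ^ ((CARD('a) - 1) * (i div (CARD('a) - 1)) + i mod (CARD('a) - 1))" by simp
  also have "\<dots> = x ^ (i mod (CARD('a) - 1))"
    by (simp only: power_add power_mult power_card_minus_1[OF assms] power_one mult_1)
  finally show ?thesis ..
qed

lemma finite_field_generator:
  obtains g :: "'a::finite_field" where
    "g \<noteq> 0" "bij_betw (\<lambda>i. g ^ i) {..<CARD('a) - 1} (- {0})"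
    "\<And>i. g ^ i = 1 \<longleftrightarrow> CARD('a) - 1 dvd i"
proof -
  \<comment> \<open>Cyclicity of the multiplicative group is taken from HOL-Algebra, where fields
    are records; \<open>R\<close> is the type in that form and \<open>pow\<close> translates powers
    back.\<close>
  define R :: "'a ring" where
    "R = \<lparr>carrier = UNIV, monoid.mult = (*), one = 1, ring.zero = 0, add = (+)\<rparr>"
  interpret R: field R unfolding R_def by (rule field_type_ring)
  have pow: "x [^]\<^bsub>R\<^esub> (i::nat) = x ^ i" for x i
    by (induction i) (auto simp: R_def nat_pow_def mult.commute)
  obtain g where g: "g \<in> carrier (mult_of R)"
     "carrier (mult_of R) = {g [^]\<^bsub>R\<^esub> i | i::nat. i \<in> UNIV}"
    using R.finite_field_mult_group_has_gen by (auto simp: R_def)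
  have g0: "g \<noteq> 0" using g(1) by (auto simp: R_def)
  have all: "\<exists>i. x = g ^ i" if "x \<noteq> 0" for x
  proof -
    have "x \<in> carrier (mult_of R)" using that by (simp add: R_def)
    then show ?thesis unfolding g(2) by (auto simp: pow)
  qed
  define N where "N = CARD('a) - 1"
  have N0: "N > 0" using card_units_pos unfolding N_def .
  have surj: "(\<lambda>i. g ^ i) ` {..<N} = - {0}"
  proof
    show "(\<lambda>i. g ^ i) ` {..<N} \<subseteq> - {0}" using g0 by auto
    show "- {0} \<subseteq> (\<lambda>i. g ^ i) ` {..<N}"
    proof
      fix x :: 'a assume "x \<in> - {0}"
      then obtain i where "x = g ^ i" using all by auto
      then have "x = g ^ (i mod N)" using power_mod_card[OF g0] N_def by metis
      then show "x \<in> (\<lambda>i. g ^ i) ` {..<N}" using N0 by auto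
    qed
  qed
  have "card (- {0::'a}) = N" by (simp add: card_nonzero N_def)
  then have bij: "bij_betw (\<lambda>i. g ^ i) {..<N} (- {0})"
    using surj eq_card_imp_inj_on[of "{..<N}" "\<lambda>i. g ^ i"] by (simp add: bij_betw_def)
  have "g ^ i = 1 \<longleftrightarrow> N dvd i" for i
  proof -
    have "g ^ i = 1 \<longleftrightarrow> g ^ (i mod N) = g ^ 0"
      using power_mod_card[OF g0] N_def by simp
    also have "\<dots> \<longleftrightarrow> i mod N = 0"
      using bij N0 unfolding bij_betw_def inj_on_def by (metis lessThan_iff mod_less_divisor)
    finally show ?thesis by (simp add: dvd_eq_mod_eq_0)
  qed
  with bij g0 that show thesis unfolding N_def by blast
qed

text \<open>Euler's criterion. Writing \<open>a = g ^ i\<close> for a generator \<open>g\<close>,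
  the right side says that \<open>N\<close> divides \<open>i * (N div d)\<close>, that is,
  \<open>d\<close> divides \<open>i\<close>.\<close>

lemma power_image_iff:
  fixes a :: "'a::finite_field"
  assumes "d dvd CARD('a) - 1" "a \<noteq> 0"
  shows "(\<exists>x. a = x ^ d) \<longleftrightarrow> a ^ ((CARD('a) - 1) div d) = 1"
proof
  define N where "N = CARD('a) - 1"
  have N0: "N > 0" using card_units_pos unfolding N_def .
  note dN = assms(1)[folded N_def]
  have d0: "d > 0" using dN N0 by (auto intro: Nat.gr0I)
  {
    assume "\<exists>x. a = x ^ d"
    then obtain x where x: "a = x ^ d" by blast
    with assms(2) d0 have "x \<noteq> 0" by auto
    then show "a ^ ((CARD('a) - 1) div d) = 1"
      using power_card_minus_1[of x] dN unfolding x N_def[symmetric] by (simp flip: power_mult)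
  }
  assume "a ^ ((CARD('a) - 1) div d) = 1"
  then have *: "a ^ (N div d) = 1" by (simp only: N_def)
  obtain g :: 'a where g: "g \<noteq> 0" "bij_betw (\<lambda>i. g ^ i) {..<N} (- {0})"
    "\<And>i. g ^ i = 1 \<longleftrightarrow> N dvd i"
    unfolding N_def by (rule finite_field_generator) blast
  have "a \<in> (\<lambda>i. g ^ i) ` {..<N}"
    using g(2) assms(2) unfolding bij_betw_def by auto
  then obtain i where i: "a = g ^ i" by auto
  with * have "N dvd i * (N div d)" by (simp add: g(3) flip: power_mult)
  moreover have "N = d * (N div d)" "N div d > 0" using dN N0 d0 by (auto simp: dvd_div_eq_0_iff)
  ultimately have "d dvd i"
    by (metis dvd_times_right_cancel_iff mult.commute nat_neq_iff)
  then obtain e where "i = d * e" ..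
  then have "a = (g ^ e) ^ d" using i by (simp add: mult.commute flip: power_mult)
  then show "\<exists>x. a = x ^ d" ..
qed

text \<open>In terms of a generator, \<open>g ^ i\<close> is a root iff \<open>N\<close> divides
  \<open>m * i\<close>, and this holds iff \<open>i\<close> is a multiple of
  \<open>N / gcd m N\<close>; there are \<open>gcd m N\<close> such exponents below
  \<open>N\<close>.\<close>

lemma card_roots_of_one:
  assumes "m > 0"
  shows "card {x::'a::finite_field. x ^ m = 1} = gcd m (CARD('a) - 1)"
proof -
  define N where "N = CARD('a) - 1"
  have N0: "N > 0" using card_units_pos unfolding N_def .
  obtain g :: 'a where g: "g \<noteq> 0" "bij_betw (\<lambda>i. g ^ i) {..<N} (- {0})"
    "\<And>i. g ^ i = 1 \<longleftrightarrow> N dvd i"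
    unfolding N_def by (rule finite_field_generator) blast
  define d where "d = gcd m N"
  obtain e where e: "N = d * e" unfolding d_def using gcd_dvd2 dvdE by metis
  have e0: "e > 0" "d > 0" using e N0 by (auto intro: Nat.gr0I)
  have dv: "N dvd m * i \<longleftrightarrow> e dvd i" for i
  proof -
    obtain m' where m': "m = d * m'" unfolding d_def using gcd_dvd1 dvdE by metis
    have "d * gcd m' e = gcd m N" by (subst m', subst e) (rule gcd_mult_distrib_nat)
    then have "d * gcd m' e = d * 1" by (simp only: d_def mult_1_right)
    with e0 have "coprime m' e" by (metis coprime_iff_gcd_eq_1 mult_left_cancel nat_neq_iff)
    then have "e dvd m' * i \<longleftrightarrow> e dvd i" by (simp add: coprime_commute coprime_dvd_mult_right_iff)
    moreover have "N dvd m * i \<longleftrightarrow> e dvd m' * i"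
      unfolding e m' mult.assoc using e0 by simp
    ultimately show ?thesis by simp
  qed
  have "bij_betw (\<lambda>i. g ^ i) {i\<in>{..<N}. e dvd i} {x::'a. x ^ m = 1}"
    unfolding bij_betw_def
  proof
    show "inj_on (\<lambda>i. g ^ i) {i\<in>{..<N}. e dvd i}"
      using g(2) unfolding bij_betw_def by (auto intro: inj_on_subset)
    show "(\<lambda>i. g ^ i) ` {i\<in>{..<N}. e dvd i} = {x::'a. x ^ m = 1}"
    proof (intro equalityI subsetI)
      fix x assume "x \<in> (\<lambda>i. g ^ i) ` {i\<in>{..<N}. e dvd i}"
      then show "x \<in> {x::'a. x ^ m = 1}"
        using g(3) dv by (auto simp: mult.commute simp flip: power_mult)
    next
      fix x assume x: "x \<in> {x::'a. x ^ m = 1}"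
      with assms have "x \<noteq> 0" by (auto simp: power_0_left)
      then have "x \<in> (\<lambda>i. g ^ i) ` {..<N}" using g(2) unfolding bij_betw_def by simp
      then obtain i where i: "i < N" "x = g ^ i" by auto
      with x have "N dvd m * i" by (simp add: mult.commute g(3) flip: power_mult)
      with dv i show "x \<in> (\<lambda>i. g ^ i) ` {i\<in>{..<N}. e dvd i}" by auto
    qed
  qed
  then have "card {x::'a. x ^ m = 1} = card {i\<in>{..<N}. e dvd i}" by (simp add: bij_betw_same_card)
  also have "{i\<in>{..<N}. e dvd i} = (\<lambda>j. e * j) ` {..<d}"
    using e0 unfolding e by (auto simp: image_iff elim!: dvdE)
  also have "card \<dots> = d" using e0 by (simp add: card_image inj_on_def)
  finally show ?thesis by (simp add: d_def N_def)
qed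

text \<open>The nonempty fibres of \<open>x ^ m\<close> on the units are cosets of the group of
  \<open>m\<close>-th roots of unity, hence all of the same size.\<close>

lemma sum_over_powers:
  fixes f :: "'a::finite_field \<Rightarrow> 'b::comm_semiring_1"
  assumes "m > 0"
  shows "(\<Sum>x\<in>-{0}. f (x ^ m)) = of_nat (gcd m (CARD('a) - 1)) * (\<Sum>y\<in>(\<lambda>x. x ^ m) ` (-{0}). f y)"
proof -
  have "(\<Sum>x\<in>-{0}. f (x ^ m)) = (\<Sum>y\<in>(\<lambda>x. x ^ m) ` (-{0}). \<Sum>x\<in>{x\<in>-{0::'a}. x ^ m = y}. f (x ^ m))"
    by (rule sum.image_gen) simp
  also have "\<dots> = (\<Sum>y\<in>(\<lambda>x. x ^ m) ` (-{0::'a}). of_nat (gcd m (CARD('a) - 1)) * f y)"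
  proof (rule sum.cong[OF refl])
    fix y assume "y \<in> (\<lambda>x. x ^ m) ` (-{0::'a})"
    then obtain z where z: "z \<noteq> 0" "y = z ^ m" by auto
    have "bij_betw (\<lambda>x. z * x) {x::'a. x ^ m = 1} {x\<in>-{0}. x ^ m = y}"
      by (rule bij_betw_byWitness[of _ "\<lambda>x. x / z"])
         (use z assms in \<open>auto simp: power_mult_distrib power_divide power_0_left\<close>)
    then have "card {x\<in>-{0}. x ^ m = y} = gcd m (CARD('a) - 1)"
      using card_roots_of_one[OF assms, where ?'a='a] by (metis bij_betw_same_card)
    then show "(\<Sum>x\<in>{x\<in>-{0::'a}. x ^ m = y}. f (x ^ m)) = of_nat (gcd m (CARD('a) - 1)) * f y"
      by simp
  qed
  finally show ?thesis by (simp add: sum_distrib_left)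
qed

text \<open>One inclusion is clear since the gcd divides \<open>m\<close>. Equality follows by size:
  both power maps have fibres of the same size on the units, as \<open>sum_over_powers\<close> shows
  for the constant function 1.\<close>

lemma power_image_gcd:
  assumes "m > 0"
  shows "(\<lambda>x::'a::finite_field. x ^ m) ` (-{0}) = (\<lambda>x. x ^ gcd m (CARD('a) - 1)) ` (-{0})" (is "?A = ?B")
proof (rule card_subset_eq)
  let ?d = "gcd m (CARD('a) - 1)"
  have d0: "?d > 0" using assms by simp
  show "finite ?B" by simp
  obtain m' where m': "m = ?d * m'" using gcd_dvd1 dvdE by metis
  show "?A \<subseteq> ?B"
  proof
    fix y assume "y \<in> ?A"
    then obtain x where x: "x \<noteq> 0" "y = x ^ m" by auto
    have "y = (x ^ m') ^ ?d" unfolding x(2) by (subst m') (simp add: mult.commute flip: power_mult)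
    with x show "y \<in> ?B" by (intro image_eqI[of _ _ "x ^ m'"]) auto
  qed
  have "?d * card ?A = ?d * card ?B"
    using sum_over_powers[OF assms, of "\<lambda>_::'a. 1::nat"] sum_over_powers[OF d0, of "\<lambda>_::'a. 1::nat"]
    by simp
  with d0 show "card ?A = card ?B" by (metis mult_left_cancel less_not_refl2)
qed

text \<open>This lets every exponent \<open>m j\<close> be replaced by \<open>d j\<close>, which is
  all the character sums see of it.\<close>

lemma sum_over_powers_gcd:
  fixes f :: "'a::finite_field \<Rightarrow> 'b::comm_semiring_1"
  assumes "m > 0"
  shows "(\<Sum>x\<in>-{0}. f (x ^ m)) = (\<Sum>x\<in>-{0}. f (x ^ gcd m (CARD('a) - 1)))"
proof -
  have "gcd m (CARD('a) - 1) > 0" using assms by simp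
  moreover have "gcd (gcd m (CARD('a) - 1)) (CARD('a) - 1) = gcd m (CARD('a) - 1)" by simp
  ultimately show ?thesis
    using sum_over_powers[of "gcd m (CARD('a) - 1)" f] sum_over_powers[OF assms, of f]
    by (simp only: power_image_gcd[OF assms, symmetric])
qed

lemma sum_unit_translate:
  fixes f :: "'a::finite_field \<Rightarrow> 'b::comm_monoid_add"
  assumes "u \<noteq> 0"
  shows "(\<Sum>x\<in>-{0}. f (u * x)) = (\<Sum>x\<in>-{0}. f x)"
  by (rule sum.reindex_bij_witness[of _ "\<lambda>y. y / u" "\<lambda>x. u * x"]) (use assms in auto)

section \<open>The numbers $I$ as character sums\<close>

lemma cis_2pi_eq_1_iff: "cis (2 * pi * r) = 1 \<longleftrightarrow> r \<in> \<int>"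
proof
  assume "r \<in> \<int>"
  then obtain k where "r = of_int k" by (elim Ints_cases)
  then show "cis (2 * pi * r) = 1" by simp
next
  assume "cis (2 * pi * r) = 1"
  then have "cos (2 * pi * r) = 1" by (simp add: complex_eq_iff)
  then obtain k :: int where "2 * pi * r = 2 * pi * of_int k"
    unfolding cos_one_2pi_int by (auto simp: mult_ac)
  then show "r \<in> \<int>" by simp
qed

lemma of_nat_div_in_Ints_iff:
  assumes "d > 0"
  shows "real i / real d \<in> \<int> \<longleftrightarrow> d dvd i"
proof
  assume "real i / real d \<in> \<int>"
  then obtain k where k: "real i / real d = of_int k" by (elim Ints_cases)
  with assms have "real i = of_int k * real d" by (simp add: field_simps)
  then have "real_of_int (int i) = of_int (k * int d)" by simp
  then have "int i = k * int d" by (simp only: of_int_eq_iff)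
  then have "int d dvd int i" by simp
  then show "d dvd i" by simp
next
  assume "d dvd i"
  with assms show "real i / real d \<in> \<int>" by (auto elim!: dvdE)
qed

lemma sum_cis_period:
  assumes "N > 0" and rN: "real N * r \<in> \<int>"
  shows "(\<Sum>i<N. cis (2 * pi * real i * r)) = (if r \<in> \<int> then of_nat N else 0)"
proof -
  define z where "z = cis (2 * pi * r)"
  have pw: "cis (2 * pi * real i * r) = z ^ i" for i
    unfolding z_def by (simp add: Complex.DeMoivre mult_ac)
  have z1: "z = 1 \<longleftrightarrow> r \<in> \<int>" unfolding z_def by (rule cis_2pi_eq_1_iff)
  have "z ^ N = 1"
  proof -
    obtain k where k: "of_nat N * r = of_int k" using rN by (elim Ints_cases)
    have "z ^ N = cis (2 * pi * (of_nat N * r))" using pw[of N] by (simp add: mult_ac)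
    then show ?thesis unfolding k by simp
  qed
  then show ?thesis
    unfolding pw using z1 by (auto simp: sum_gp_strict)
qed

text \<open>The full geometric sum over \<open>t < d\<close> minus its term \<open>t = 0\<close>.
  The range \<open>1..d-1\<close> left over is the one in the definition of
  \<open>Icount\<close>.\<close>

lemma sum_cis_divisor:
  assumes "d > 0"
  shows "(\<Sum>t=1..d-1. cis (2 * pi * real i * (real t / real d))) = of_nat d * of_bool (d dvd i) - 1"
proof -
  have "real d * (real i / real d) \<in> \<int>" using assms by simp
  from sum_cis_period[OF assms this]
  have "(\<Sum>t<d. cis (2 * pi * real i * (real t / real d))) = of_nat d * of_bool (real i / real d \<in> \<int>)"
    by (simp add: mult_ac)
  moreover have "real i / real d \<in> \<int> \<longleftrightarrow> d dvd i" using assms by (rule of_nat_div_in_Ints_iff)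
  moreover have "{..<d} = insert 0 {1..d-1}" using assms by (auto simp: set_eq_iff)
  then have "(\<Sum>t<d. cis (2 * pi * real i * (real t / real d)))
      = 1 + (\<Sum>t=1..d-1. cis (2 * pi * real i * (real t / real d)))"
    by (simp only:) (subst sum.insert, simp_all)
  ultimately show ?thesis by (simp only: eq_diff_eq add.commute)
qed

lemma Icount_character_sum:
  assumes "finite J" "N > 0" "\<And>j. j \<in> J \<Longrightarrow> d j dvd N"
  shows "(\<Sum>i<N. \<Prod>j\<in>J. real (d j) * of_bool (d j dvd i) - 1) = real N * real (Icount d J)"
proof -
  let ?P = "PiE J (\<lambda>i. {1..d i - 1})"
  define r where "r t = (\<Sum>j\<in>J. real (t j) / real (d j))" for t
  have d0: "d j > 0" if "j \<in> J" for j using assms(2) assms(3)[OF that] by (auto intro: Nat.gr0I)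
  \<comment> \<open>\<open>Icount\<close> tests integrality in the rationals, whereas
    \<open>cis\<close> takes real arguments.\<close>
  have rat: "r t \<in> \<int> \<longleftrightarrow> (\<Sum>j\<in>J. of_nat (t j) / of_nat (d j) :: rat) \<in> \<int>" for t
  proof -
    have "r t = of_rat (\<Sum>j\<in>J. of_nat (t j) / of_nat (d j) :: rat)"
      by (simp add: r_def of_rat_sum of_rat_divide)
    moreover have "of_rat y \<in> (\<int> :: real set) \<longleftrightarrow> y \<in> \<int>" for y
    proof
      assume "of_rat y \<in> (\<int> :: real set)"
      then obtain z where "(of_rat y :: real) = of_int z" by (elim Ints_cases)
      then have "of_rat y = (of_rat (of_int z) :: real)" by simp
      then have "y = of_int z" by (simp only: of_rat_eq_iff)
      then show "y \<in> \<int>" by simp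
    qed (auto elim!: Ints_cases)
    ultimately show ?thesis by simp
  qed
  have int: "real N * r t \<in> \<int>" for t
  proof -
    have "real N * (real (t j) / real (d j)) \<in> \<int>" if j: "j \<in> J" for j
    proof -
      obtain e where "N = d j * e" using assms(3)[OF j] by (elim dvdE)
      then have "real N * (real (t j) / real (d j)) = real (e * t j)" using d0[OF j] by simp
      then show ?thesis by (simp only: Ints_of_nat)
    qed
    then show ?thesis unfolding r_def sum_distrib_left by (intro Ints_sum)
  qed
  have fin: "finite ?P" using assms(1) by (intro finite_PiE) auto
  have "complex_of_real (\<Sum>i<N. \<Prod>j\<in>J. real (d j) * of_bool (d j dvd i) - 1)
      = (\<Sum>i<N. \<Prod>j\<in>J. \<Sum>t=1..d j-1. cis (2 * pi * real i * (real t / real (d j))))"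
    unfolding of_real_sum of_real_prod
  proof (intro sum.cong prod.cong refl)
    fix i j assume "j \<in> J"
    from sum_cis_divisor[OF d0[OF this], of i]
    show "complex_of_real (real (d j) * of_bool (d j dvd i) - 1)
        = (\<Sum>t=1..d j-1. cis (2 * pi * real i * (real t / real (d j))))"
      by simp
  qed
  also have "\<dots> = (\<Sum>i<N. \<Sum>t\<in>?P. \<Prod>j\<in>J. cis (2 * pi * real i * (real (t j) / real (d j))))"
    by (intro sum.cong refl prod_sum_PiE assms(1)) auto
  also have "\<dots> = (\<Sum>i<N. \<Sum>t\<in>?P. cis (2 * pi * real i * r t))"
  proof -
    have "(\<Prod>j\<in>J. cis (2 * pi * real i * (real (t j) / real (d j)))) = cis (2 * pi * real i * r t)" for i t
      unfolding r_def sum_distrib_left using assms(1)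
      by (induction J rule: finite_induct) (auto simp: cis_mult)
    then show ?thesis by (simp only:)
  qed
  also have "\<dots> = (\<Sum>t\<in>?P. \<Sum>i<N. cis (2 * pi * real i * r t))" by (rule sum.swap)
  also have "\<dots> = (\<Sum>t\<in>?P. if r t \<in> \<int> then of_nat N else 0)"
    by (intro sum.cong refl sum_cis_period assms(2) int)
  also have "\<dots> = of_nat (N * card {t\<in>?P. r t \<in> \<int>})"
    using fin by (simp add: sum.If_cases Int_def mult.commute)
  also have "\<dots> = of_real (real N * real (Icount d J))"
    by (simp add: Icount_def rat)
  finally show ?thesis using of_real_eq_iff by blast
qed

text \<open>With the period \<open>D\<close> itself, the index \<open>i = 0\<close> gives every
  factor the value \<open>D - 1\<close>, and each of the other \<open>D - 1\<close> indices gives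
  -1.\<close>

lemma Icount_const:
  assumes "finite J" "D > 0" "\<And>j. j \<in> J \<Longrightarrow> d j = D"
  shows "real (Icount d J) = ((real D - 1) ^ card J + (-1) ^ card J * (real D - 1)) / real D"
proof -
  have "real D * real (Icount d J) = (\<Sum>i<D. \<Prod>j\<in>J. real (d j) * of_bool (d j dvd i) - 1)"
    by (rule Icount_character_sum[symmetric]) (use assms in auto)
  also have "\<dots> = (\<Sum>i<D. (real D * of_bool (D dvd i) - 1) ^ card J)"
    using assms(3) by (intro sum.cong refl) simp
  also have "{..<D} = insert 0 {1..<D}" using assms(2) by auto
  also have "(\<Sum>i\<in>insert 0 {1..<D}. (real D * of_bool (D dvd i) - 1) ^ card J)
     = (real D - 1) ^ card J + (\<Sum>i\<in>{1..<D}. (-1) ^ card J)"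
  proof -
    have "real D * of_bool (D dvd i) - 1 = -1" if "i \<in> {1..<D}" for i
      using that by (auto dest: dvd_imp_le)
    then show ?thesis by (subst sum.insert) auto
  qed
  also have "\<dots> = (real D - 1) ^ card J + (-1) ^ card J * (real D - 1)"
    using assms(2) by (simp add: of_nat_diff mult.commute)
  finally show ?thesis using assms(2) by (simp add: field_simps)
qed

lemma Icount_empty: "Icount d {} = 1"
proof -
  have "{t \<in> PiE {} (\<lambda>i. {1..d i - 1}). (\<Sum>i\<in>{}. of_nat (t i) / of_nat (d i) :: rat) \<in> \<int>} = {\<lambda>_. undefined}"
    by auto
  then show ?thesis unfolding Icount_def by simp
qed

lemma Icount_singleton:
  assumes "d j > 0"
  shows "Icount d {j} = 0"
proof -
  have "real (Icount d {j}) = ((real (d j) - 1) ^ card {j} + (-1) ^ card {j} * (real (d j) - 1)) / real (d j)"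
    by (rule Icount_const) (use assms in auto)
  then show ?thesis by simp
qed

text \<open>For a generator \<open>g\<close>, the element \<open>g ^ i\<close> is a
  \<open>d j\<close>-th power iff \<open>d j\<close> divides \<open>i\<close>. This carries the sum
  over units to the sum over exponents in \<open>Icount_character_sum\<close>.\<close>

lemma sum_units_Icount:
  assumes "finite J" "\<And>j. j \<in> J \<Longrightarrow> d j dvd CARD('a) - 1"
  shows "(\<Sum>a\<in>-{0::'a::finite_field}. \<Prod>j\<in>J. real (d j) * of_bool (\<exists>x. a = x ^ d j) - 1)
    = real (CARD('a) - 1) * real (Icount d J)"
proof -
  define N where "N = CARD('a) - 1"
  have N0: "N > 0" using card_units_pos unfolding N_def .
  obtain g :: 'a where g: "g \<noteq> 0" "bij_betw (\<lambda>i. g ^ i) {..<N} (- {0})"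
    "\<And>i. g ^ i = 1 \<longleftrightarrow> N dvd i"
    unfolding N_def by (rule finite_field_generator) blast
  have iff: "(\<exists>x. g ^ i = x ^ d j) \<longleftrightarrow> d j dvd i" if "j \<in> J" for i j
  proof -
    have dv: "d j dvd N" using assms(2)[OF that] N_def by simp
    then obtain e where e: "N = d j * e" ..
    with N0 have e0: "d j > 0" "e > 0" by (auto intro: Nat.gr0I)
    have "(\<exists>x. g ^ i = x ^ d j) \<longleftrightarrow> (g ^ i) ^ (N div d j) = 1"
      unfolding N_def by (rule power_image_iff) (use g(1) dv N_def in auto)
    also have "\<dots> \<longleftrightarrow> N dvd i * e" using e0 by (simp add: e g(3) flip: power_mult)
    also have "\<dots> \<longleftrightarrow> d j dvd i" using e0 by (simp add: e)
    finally show ?thesis .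
  qed
  have "(\<Sum>a\<in>-{0::'a}. \<Prod>j\<in>J. real (d j) * of_bool (\<exists>x. a = x ^ d j) - 1)
     = (\<Sum>i<N. \<Prod>j\<in>J. real (d j) * of_bool (\<exists>x. g ^ i = x ^ d j) - 1)"
    by (rule sum.reindex_bij_betw[OF g(2), symmetric])
  also have "\<dots> = (\<Sum>i<N. \<Prod>j\<in>J. real (d j) * of_bool (d j dvd i) - 1)"
    by (intro sum.cong prod.cong refl) (simp add: iff)
  also have "\<dots> = real N * real (Icount d J)"
    by (rule Icount_character_sum) (use assms N0 N_def in auto)
  finally show ?thesis unfolding N_def .
qed

section \<open>Additive characters\<close>

lemma of_nat_power_CHAR: "(of_nat i :: 'a::finite_field) ^ CHAR('a) = of_nat i"
proof (induction i)
  case 0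
  show ?case by (simp add: power_0_left)
next
  case (Suc i)
  then show ?case using freshmans_dream[OF CHAR_prime refl, of 1 "of_nat i :: 'a"] by simp
qed

lemma minus_power_CHAR_power: "(- x :: 'a::finite_field) ^ (CHAR('a) ^ n) = - (x ^ (CHAR('a) ^ n))"
proof (induction n)
  case (Suc n)
  have "(- x) ^ (CHAR('a) ^ Suc n) = ((- x) ^ (CHAR('a) ^ n)) ^ CHAR('a)"
    by (simp only: power_Suc2 power_mult)
  also have "\<dots> = - ((x ^ (CHAR('a) ^ n)) ^ CHAR('a))"
    unfolding Suc by (rule minus_power_prime_CHAR) simp_all
  finally show ?case by (simp only: power_Suc2 power_mult)
qed simp

text \<open>The equation \<open>y ^ (p - 1) = 1\<close> has at most \<open>p - 1\<close> solutions,
  and the images of \<open>1, ..., p - 1\<close> already supply that many.\<close>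

lemma prime_subfield_eq:
  fixes x :: "'a::finite_field"
  assumes "x ^ CHAR('a) = x"
  shows "\<exists>i<CHAR('a). x = of_nat i"
proof (cases "x = 0")
  case True
  then show ?thesis by (intro exI[of _ 0]) simp
next
  case False
  define p where "p = CHAR('a)"
  have p: "p > 1" unfolding p_def using CHAR_prime prime_gt_1_nat by blast
  have inj: "inj_on (of_nat :: nat \<Rightarrow> 'a) {1..<p}"
    by (intro inj_onI) (auto simp: of_nat_eq_iff_cong_CHAR p_def cong_def)
  have root: "(y::'a) ^ (p - 1) = 1" if "y ^ p = y" "y \<noteq> 0" for y
  proof -
    have "y * y ^ (p - 1) = y * 1" using that p by (metis power_minus_mult mult.commute mult.right_neutral less_trans zero_less_one)
    then show ?thesis using that(2) mult_cancel_left by blast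
  qed
  have nz: "(of_nat i :: 'a) \<noteq> 0" if "i \<in> {1..<p}" for i
    using that by (auto simp: of_nat_eq_0_iff_char_dvd p_def dest: dvd_imp_le)
  have sub: "of_nat ` {1..<p} \<subseteq> {y::'a. y ^ (p - 1) = 1}"
  proof
    fix y :: 'a assume "y \<in> of_nat ` {1..<p}"
    then obtain i where "i \<in> {1..<p}" "y = of_nat i" by blast
    then show "y \<in> {y. y ^ (p - 1) = 1}" using root[of y] nz[of i] of_nat_power_CHAR[of i, where ?'a='a] p_def by simp
  qed
  have "card {y::'a. y ^ (p - 1) = 1} = gcd (p - 1) (CARD('a) - 1)"
    using p by (intro card_roots_of_one) simp
  also have "\<dots> \<le> p - 1" using p by (intro gcd_le1_nat) simp
  also have "\<dots> = card (of_nat ` {1..<p} :: 'a set)" using inj by (simp add: card_image)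
  finally have "of_nat ` {1..<p} = {y::'a. y ^ (p - 1) = 1}"
    using sub by (intro card_seteq) auto
  moreover have "x ^ (p - 1) = 1" using root[of x] assms False p_def by simp
  ultimately have "x \<in> of_nat ` {1..<p}" by simp
  then show ?thesis unfolding p_def by auto
qed

text \<open>
  For odd characteristic \<open>antifixed\<close> follows from \<open>add\<close> and \<open>frob\<close>; in characteristic 2 it
  needs that $\psi$ factors through the absolute trace.
\<close>

locale trace_character =
  fixes \<psi> :: "'a::finite_field \<Rightarrow> complex" and s :: nat
  assumes card_field: "CARD('a) = CHAR('a) ^ s"
    and add: "\<psi> (x + y) = \<psi> x * \<psi> y"
    and zero: "\<psi> 0 = 1"
    and frob: "\<psi> (x ^ CHAR('a)) = \<psi> x"
    and nontriv: "\<exists>x. \<psi> x \<noteq> 1"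
    and antifixed: "2 * l dvd s \<Longrightarrow> z ^ (CHAR('a) ^ l) = - z \<Longrightarrow> \<psi> z = 1"

text \<open>The character is the canonical one, \<open>x\<close> mapped to
  \<open>exp (2 pi i Tr(x) / p)\<close> with the absolute trace \<open>tr\<close>. Since
  \<open>tr x ^ p = tr x\<close>, the trace lies in the prime field and has a representative
  \<open>idx x\<close> below \<open>p\<close>.\<close>

lemma trace_character_exists:
  assumes card: "CARD('a::finite_field) = CHAR('a) ^ s"
  shows "\<exists>\<psi> :: 'a \<Rightarrow> complex. trace_character \<psi> s"
proof -
  define p where "p = CHAR('a)"
  have p: "p > 1" unfolding p_def using CHAR_prime prime_gt_1_nat by blast
  define tr :: "'a \<Rightarrow> 'a" where "tr x = (\<Sum>i<s. x ^ (p ^ i))" for x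
  have s0: "s > 0"
  proof (rule ccontr)
    assume "\<not> s > 0"
    then have "CARD('a) - 1 = 0" using card by simp
    then show False using card_units_pos[where ?'a='a] by simp
  qed
  have tr_add: "tr (x + y) = tr x + tr y" for x y
  proof -
    have "(x + y) ^ (p ^ i) = x ^ (p ^ i) + y ^ (p ^ i)" for i
      by (rule freshmans_dream'[where n=i]) (simp_all add: p_def)
    then show ?thesis unfolding tr_def by (simp add: sum.distrib)
  qed
  have tr_frob: "tr (x ^ p) = tr x" for x
  proof -
    have "tr (x ^ p) = (\<Sum>i<s. x ^ (p ^ Suc i))"
      unfolding tr_def by (simp flip: power_mult)
    also have "\<dots> + x = (\<Sum>i<Suc s. x ^ (p ^ i))"
      by (subst sum.lessThan_Suc_shift) simp
    also have "\<dots> = tr x + x"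
      using finite_field_power_card_eq_same[of x] card by (simp add: tr_def p_def)
    finally show ?thesis by simp
  qed
  have "tr x ^ p = tr (x ^ p)" for x
    unfolding tr_def
    by (subst freshmans_dream_sum) (simp_all add: p_def mult.commute flip: power_mult)
  then have "\<exists>i<p. tr x = of_nat i" for x
    using prime_subfield_eq[of "tr x"] tr_frob p_def by simp
  then obtain idx where idx: "\<And>x. idx x < p" "\<And>x. tr x = of_nat (idx x)" by metis
  define w where "w = cis (2 * pi / real p)"
  have w_pow: "w ^ i = 1 \<longleftrightarrow> p dvd i" for i
  proof -
    have "w ^ i = cis (2 * pi * (real i / real p))" unfolding w_def by (simp add: Complex.DeMoivre mult_ac)
    also have "\<dots> = 1 \<longleftrightarrow> p dvd i"
      using of_nat_div_in_Ints_iff[of p i] p by (simp only: cis_2pi_eq_1_iff)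
    finally show ?thesis .
  qed
  have w_cong: "w ^ i = w ^ j" if "[i = j] (mod p)" for i j
  proof -
    have "w ^ i = w ^ (i mod p)" for i
      using w_pow[of p] by (metis dvd_refl mod_mult_div_eq mult.left_neutral mult.commute power_add power_mult power_one)
    then show ?thesis using that unfolding cong_def by metis
  qed
  define \<psi> where "\<psi> x = w ^ idx x" for x
  have \<psi>: "\<psi> x = w ^ i" if "tr x = of_nat i" for x i
    unfolding \<psi>_def using that idx(2)[of x] by (intro w_cong) (simp add: of_nat_eq_iff_cong_CHAR p_def)
  have "trace_character \<psi> s"
  proof
    show "CARD('a) = CHAR('a) ^ s" by (fact card)
    show "\<psi> (x + y) = \<psi> x * \<psi> y" for x y
    proof -
      have "tr (x + y) = of_nat (idx x + idx y)" by (simp only: tr_add of_nat_add flip: idx(2))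
      then show ?thesis using \<psi> by (simp only: power_add) (simp only: \<psi>_def)
    qed
    show "\<psi> 0 = 1" using \<psi>[of 0 0] p by (simp add: tr_def power_0_left)
    show "\<psi> (x ^ CHAR('a)) = \<psi> x" for x
    proof -
      have "tr (x ^ p) = of_nat (idx x)" by (simp only: tr_frob flip: idx(2))
      then show ?thesis using \<psi> unfolding p_def by (simp only: \<psi>_def)
    qed
    show "\<exists>x. \<psi> x \<noteq> 1"
    proof -
      \<comment> \<open>The trace as a polynomial: its degree is at most \<open>p ^ (s - 1)\<close>,
        less than the size of the field, so it cannot vanish everywhere.\<close>
      define P :: "'a poly" where "P = (\<Sum>i<s. Polynomial.monom 1 (p ^ i))"
      have "Polynomial.coeff P (p ^ (s - 1)) = (\<Sum>i<s. if i = s - 1 then 1 else 0)"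
        unfolding P_def coeff_sum
        using p by (intro sum.cong refl) (simp add: power_inject_exp)
      then have "Polynomial.coeff P (p ^ (s - 1)) = 1" using s0 by simp
      then have P0: "P \<noteq> 0" by auto
      have "Polynomial.degree P \<le> p ^ (s - 1)" unfolding P_def
      proof (intro degree_sum_le)
        fix i assume "i \<in> {..<s}"
        then have "p ^ i \<le> p ^ (s - 1)" using p by (intro power_increasing) auto
        then show "Polynomial.degree (Polynomial.monom (1::'a) (p ^ i)) \<le> p ^ (s - 1)"
          by (meson degree_monom_le le_trans)
      qed simp
      then have "card {x. poly P x = 0} \<le> p ^ (s - 1)"
        using card_poly_roots_bound[OF P0] by linarith
      also have "\<dots> < p ^ s" using p s0 by (intro power_strict_increasing) auto
      finally have "{x. poly P x = 0} \<noteq> UNIV" using card p_def by auto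
      then obtain x where "poly P x \<noteq> 0" by blast
      then have "tr x \<noteq> 0" by (simp add: P_def tr_def poly_sum poly_monom)
      then have "idx x \<noteq> 0" using idx(2)[of x] by (metis of_nat_0)
      then have "\<not> p dvd idx x" using idx(1)[of x] by (auto dest: dvd_imp_le)
      then show ?thesis unfolding \<psi>_def using w_pow by blast
    qed
    show "\<psi> z = 1" if l: "2 * l dvd s" and z: "z ^ (CHAR('a) ^ l) = - z" for l z
    proof -
      obtain k where "s = 2 * l * k" using l by (elim dvdE)
      then obtain g where g: "s = l * (2 * g)" by (intro that[of k]) simp
      \<comment> \<open>The trace is cut into \<open>2 * g\<close> blocks of \<open>l\<close>
        consecutive conjugates. Raising to the power \<open>p ^ l\<close> negates \<open>z\<close>,
        so the block sums are \<open>A, -A, A, ...\<close> and cancel in pairs. This works in every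
        characteristic.\<close>
      define A where "A = (\<Sum>i<l. z ^ (p ^ i))"
      have shift: "(\<Sum>i\<in>{l*j..<l*j+l}. z ^ (p ^ i)) = (-1) ^ j * A" for j
      proof (induction j)
        case 0
        then show ?case by (simp add: A_def atLeast0LessThan)
      next
        case (Suc j)
        have "(\<Sum>i\<in>{l * Suc j..<l * Suc j + l}. z ^ (p ^ i)) = (\<Sum>i\<in>{l*j..<l*j+l}. z ^ (p ^ (i + l)))"
          using sum.shift_bounds_nat_ivl[of "\<lambda>i. z ^ (p ^ i)" "l*j" l "l*j+l"]
          by (simp add: add_ac)
        also have "\<dots> = (\<Sum>i\<in>{l*j..<l*j+l}. - (z ^ (p ^ i)))"
        proof (intro sum.cong refl)
          fix i
          have "z ^ (p ^ (i + l)) = (z ^ (p ^ l)) ^ (p ^ i)"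
            by (simp add: power_add mult.commute flip: power_mult)
          also have "\<dots> = - (z ^ (p ^ i))"
            using z minus_power_CHAR_power[of z i] by (simp add: p_def)
          finally show "z ^ (p ^ (i + l)) = - (z ^ (p ^ i))" .
        qed
        also have "\<dots> = (-1) ^ Suc j * A" using Suc by (simp add: sum_negf)
        finally show ?case .
      qed
      have "(\<Sum>i<l*m. z ^ (p ^ i)) = (\<Sum>j<m. (-1) ^ j) * A" for m
      proof (induction m)
        case (Suc m)
        have "{..<l * Suc m} = {..<l*m} \<union> {l*m..<l*m+l}" by auto
        then have "(\<Sum>i<l*Suc m. z ^ (p ^ i)) = (\<Sum>i<l*m. z ^ (p ^ i)) + (\<Sum>i\<in>{l*m..<l*m+l}. z ^ (p ^ i))"
          by (simp add: sum.union_disjoint ivl_disj_int)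
        with Suc shift[of m] show ?case by (simp add: algebra_simps)
      qed simp
      then have "tr z = (\<Sum>j<2*g. (-1) ^ j) * A" unfolding tr_def g by simp
      also have "(\<Sum>j<2*g. (-1::'a) ^ j) = 0" by (induction g) simp_all
      finally have "tr z = of_nat 0" by simp
      from \<psi>[OF this] show ?thesis by simp
    qed
  qed
  then show ?thesis by blast
qed

section \<open>Semiprimitive power sums\<close>

context trace_character
begin

lemma p_gt_1: "CHAR('a) > 1"
  using CHAR_prime prime_gt_1_nat by blast

lemma multiple: "\<psi> (of_nat i * x) = \<psi> x ^ i"
  by (induction i) (simp_all add: zero add distrib_right)

lemma frob_power: "\<psi> (x ^ (CHAR('a) ^ i)) = \<psi> x"
proof (induction i)
  case (Suc i)
  have "x ^ (CHAR('a) ^ Suc i) = (x ^ (CHAR('a) ^ i)) ^ CHAR('a)" by (simp only: power_Suc2 power_mult)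
  then show ?case using Suc frob by simp
qed simp

lemma sum_all: "(\<Sum>x\<in>UNIV. \<psi> x) = 0"
proof -
  obtain c where c: "\<psi> c \<noteq> 1" using nontriv by blast
  have "(\<Sum>x\<in>UNIV. \<psi> x) = (\<Sum>x\<in>UNIV. \<psi> (c + x))"
    by (rule sum.reindex_bij_witness[of _ "\<lambda>x. c + x" "\<lambda>x. x - c"]) auto
  also have "\<dots> = \<psi> c * (\<Sum>x\<in>UNIV. \<psi> x)" by (simp add: add sum_distrib_left)
  finally show ?thesis using c by simp
qed

lemma orthogonality: "(\<Sum>x\<in>UNIV. \<psi> (c * x)) = of_nat CARD('a) * of_bool (c = 0)"
proof (cases "c = 0")
  case False
  have "(\<Sum>x\<in>UNIV. \<psi> (c * x)) = (\<Sum>x\<in>UNIV. \<psi> x)"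
    by (rule sum.reindex_bij_witness[of _ "\<lambda>x. x / c" "\<lambda>x. c * x"]) (use False in auto)
  with False show ?thesis by (simp add: sum_all)
qed (simp add: zero)

text \<open>Fourier inversion on the prime field: it turns the condition
  \<open>\<psi> x = \<zeta>\<close> into character values, so that \<open>W_integer\<close> can
  count how often a given root of unity occurs.\<close>

lemma prime_field_sum:
  assumes "\<zeta> ^ CHAR('a) = 1"
  shows "(\<Sum>i<CHAR('a). \<psi> (of_nat i * x) / \<zeta> ^ i) = of_nat CHAR('a) * of_bool (\<psi> x = \<zeta>)"
proof -
  have z0: "\<zeta> \<noteq> 0" using assms p_gt_1 by (auto simp: power_0_left)
  define r where "r = \<psi> x / \<zeta>"
  have "\<psi> x ^ CHAR('a) = 1" using multiple[of "CHAR('a)" x] by (simp add: zero)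
  then have "r ^ CHAR('a) = 1" using assms by (simp add: r_def power_divide)
  moreover have "(\<Sum>i<CHAR('a). \<psi> (of_nat i * x) / \<zeta> ^ i) = (\<Sum>i<CHAR('a). r ^ i)"
    by (simp add: multiple r_def power_divide)
  moreover have "\<psi> x = \<zeta> \<longleftrightarrow> r = 1" using z0 by (simp add: r_def)
  ultimately show ?thesis by (cases "r = 1") (simp_all add: sum_gp_strict)
qed

end

text \<open>The order \<open>t\<close> of \<open>p\<close> modulo \<open>D\<close> divides
  \<open>2 * l\<close> but not \<open>l\<close>, because 1 and -1 differ modulo
  \<open>D > 2\<close>. Hence \<open>t = 2 * u\<close> and \<open>l\<close> is an odd multiple of
  \<open>u\<close>, so that \<open>p ^ u\<close> and \<open>p ^ l\<close> are both -1 modulo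
  \<open>D\<close>. Minimality of \<open>l\<close> gives \<open>u = l\<close>, so
  \<open>2 * l\<close> is the order and divides \<open>s\<close>.\<close>

lemma semiprimitive_period:
  fixes p D l s :: nat
  assumes D: "D > 2" and ex: "\<exists>l'>0. D dvd p ^ l' + 1"
    and l: "l = (LEAST l'. l' > 0 \<and> D dvd p ^ l' + 1)" and s: "[p ^ s = 1] (mod D)"
  shows "l > 0" "D dvd p ^ l + 1" "2 * l dvd s"
proof -
  have "l > 0 \<and> D dvd p ^ l + 1" unfolding l using ex by (rule LeastI_ex)
  then show l0: "l > 0" and Dl: "D dvd p ^ l + 1" by auto
  have iff: "D dvd p ^ i + 1 \<longleftrightarrow> [int p ^ i = -1] (mod int D)" for i
    unfolding cong_iff_dvd_diff by (metis diff_minus_eq_add int_dvd_int_iff of_nat_1 of_nat_add of_nat_power)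
  have ord: "[int p ^ i = 1] (mod int D) \<longleftrightarrow> ord D p dvd i" for i
    using ord_divides[of p i D] cong_int_iff[of "p ^ i" 1 D] by simp
  define t where "t = ord D p"
  have "[(int p ^ l) ^ 2 = (-1) ^ 2] (mod int D)"
    using Dl unfolding iff by (rule cong_pow)
  then have t2l: "t dvd 2 * l" unfolding t_def ord[symmetric] by (simp add: mult.commute flip: power_mult)
  have tl: "\<not> t dvd l"
  proof
    assume "t dvd l"
    then have "[int p ^ l = 1] (mod int D)" unfolding t_def ord .
    with Dl have "[1 = -1] (mod int D)" unfolding iff by (metis cong_sym cong_trans)
    then have "int D dvd 2" by (simp add: cong_iff_dvd_diff)
    then have "int D \<le> 2" by (rule zdvd_imp_le) simp
    with D show False by simp
  qed
  have "even t"
  proof (rule ccontr)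
    assume "odd t"
    then have "coprime t 2" by simp
    with t2l have "t dvd l" by (simp add: coprime_dvd_mult_right_iff)
    with tl show False by simp
  qed
  then obtain u where u: "t = 2 * u" by (elim evenE)
  with t2l have "u dvd l" by simp
  then obtain i where i: "l = u * i" by (elim dvdE)
  have "odd i"
  proof (rule ccontr)
    assume "\<not> odd i"
    then obtain j where "i = 2 * j" by (auto elim: evenE)
    with i u have "l = t * j" by simp
    with tl show False by simp
  qed
  then obtain j where j: "i = 2 * j + 1" by (elim oddE)
  have lu: "l = u + t * j" using i u j by (simp add: algebra_simps)
  have "[int p ^ (t * j) = 1] (mod int D)" unfolding ord t_def by simp
  then have "[int p ^ u * int p ^ (t * j) = int p ^ u * 1] (mod int D)" by (rule cong_scalar_left)
  then have "[int p ^ l = int p ^ u] (mod int D)" by (simp add: lu power_add)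
  with Dl have "D dvd p ^ u + 1" unfolding iff by (metis cong_sym cong_trans)
  moreover have "u > 0" using i l0 by (auto intro: Nat.gr0I)
  ultimately have "l \<le> u" unfolding l by (intro Least_le) auto
  moreover have "u \<le> l" using lu by simp
  ultimately have "t = 2 * l" using u by simp
  moreover have "t dvd s"
    unfolding t_def ord[symmetric] using s cong_int_iff[of "p ^ s" 1 D] by simp
  ultimately show "2 * l dvd s" by simp
qed

lemma power_minus_1_dvd: "(a::nat) - 1 dvd a ^ n - 1"
proof (cases "a = 0")
  case False
  then have "[a = 1] (mod (a - 1))" by (simp add: cong_altdef_nat)
  then have "[a ^ n = 1 ^ n] (mod (a - 1))" by (rule cong_pow)
  with False show ?thesis by (simp add: cong_altdef_nat)
qed (simp add: power_0_left)

section \<open>Hermitian Gauss sums over an even-degree extension of the field with \<open>Q\<close>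
  elements\<close>

locale semiprimitive_character = trace_character +
  fixes l \<gamma> :: nat
  assumes l_pos: "l > 0" and s_eq: "s = 2 * l * \<gamma>"
begin

definition Q :: nat where "Q = CHAR('a) ^ l"
definition \<epsilon> :: real where "\<epsilon> = (-1) ^ \<gamma>"
definition W :: "'a \<Rightarrow> complex" where "W a = (\<Sum>x\<in>UNIV. \<psi> (a * x ^ (Q + 1)))"

lemma Q_ge_2: "Q \<ge> 2"
proof -
  have "2 ^ 1 \<le> CHAR('a) ^ l" using p_gt_1 l_pos by (intro power_mono[THEN order_trans, of 2 "CHAR('a)" 1] power_increasing) auto
  then show ?thesis by (simp add: Q_def)
qed

lemma q_eq: "CARD('a) = Q ^ (2 * \<gamma>)"
  by (simp add: card_field s_eq Q_def mult_ac flip: power_mult)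

lemma units_factor:
  obtains E where "CARD('a) - 1 = (Q + 1) * (Q - 1) * E" "E > 0"
proof -
  have "Q\<^sup>2 - 1 dvd CARD('a) - 1" unfolding q_eq power_mult by (rule power_minus_1_dvd)
  moreover have "Q\<^sup>2 - 1 = (Q + 1) * (Q - 1)"
    by (simp add: power2_eq_square algebra_simps)
  ultimately obtain E where E: "CARD('a) - 1 = (Q + 1) * (Q - 1) * E" by (metis dvdE)
  with card_units_pos[where ?'a='a] have "E > 0" by (auto intro: Nat.gr0I)
  with E that show thesis by blast
qed

lemma frob_Q: "\<psi> (x ^ Q) = \<psi> x"
  unfolding Q_def by (rule frob_power)

lemma add_power_Q: "(x + y :: 'a) ^ Q = x ^ Q + y ^ Q"
  unfolding Q_def by (rule freshmans_dream'[where n=l]) simp_all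

lemma minus_power_Q: "(- x :: 'a) ^ Q = - (x ^ Q)"
  unfolding Q_def by (rule minus_power_CHAR_power)

lemma sum_power_Q: "(\<Sum>x\<in>UNIV. f (x ^ Q)) = (\<Sum>x\<in>UNIV. f (x::'a))"
proof (rule sum.reindex_bij_betw)
  have "inj (\<lambda>x::'a. x ^ Q)"
  proof (rule injI)
    fix x y :: 'a assume "x ^ Q = y ^ Q"
    then have "(x + - y) ^ Q = 0" by (simp only: add_power_Q minus_power_Q) simp
    then show "x = y" using Q_ge_2 by auto
  qed
  then show "bij (\<lambda>x::'a. x ^ Q)"
    using finite_UNIV_inj_surj[of "\<lambda>x::'a. x ^ Q"] by (simp add: bij_def)
qed

lemma even_power_minus_1: "even i \<or> CHAR('a) = 2 \<Longrightarrow> (- 1 :: 'a) ^ i = 1"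
proof (elim disjE)
  assume "CHAR('a) = 2"
  then have "(- 1 :: 'a) = 1" by (rule uminus_CHAR_2)
  then show "(- 1 :: 'a) ^ i = 1" by (metis power_one)
qed simp

lemma Q_odd: "CHAR('a) \<noteq> 2 \<Longrightarrow> odd Q"
  unfolding Q_def using CHAR_prime[where ?'a='a] prime_odd_nat p_gt_1 by (simp add: order_le_less)

text \<open>Both cofactors, \<open>(Q - 1) * E\<close> and \<open>(Q + 1) * E\<close>, are even for
  odd \<open>Q\<close>, and in characteristic 2 there is nothing to prove as -1 is 1. The first root
  yields \<open>W (- a) = W a\<close>; the second is the twist \<open>h\<close>.\<close>

lemma minus_1_power: "\<exists>c::'a. -1 = c ^ (Q + 1)" "\<exists>h::'a. -1 = h ^ (Q - 1)"
proof -
  obtain E where E: "CARD('a) - 1 = (Q + 1) * (Q - 1) * E" "E > 0" by (rule units_factor)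
  have dv: "Q + 1 dvd CARD('a) - 1" "Q - 1 dvd CARD('a) - 1"
    unfolding E(1) by (simp_all only: mult.assoc dvd_triv_left dvd_mult)
  have "(- 1 :: 'a) ^ ((CARD('a) - 1) div (Q + 1)) = 1"
    using Q_odd by (intro even_power_minus_1) (auto simp: E(1) div_mult_self1_is_m mult.assoc simp del: One_nat_def mult_Suc)
  then show "\<exists>c::'a. -1 = c ^ (Q + 1)"
    by (subst power_image_iff) (simp_all only: dv, simp)
  have "(CARD('a) - 1) div (Q - 1) = (Q + 1) * E" 
  proof -
    have "CARD('a) - 1 = (Q - 1) * ((Q + 1) * E)" unfolding E(1) by (simp only: mult_ac)
    then show ?thesis using Q_ge_2 by simp
  qed
  then have "(- 1 :: 'a) ^ ((CARD('a) - 1) div (Q - 1)) = 1"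
    using Q_odd by (intro even_power_minus_1) auto
  then show "\<exists>c::'a. -1 = c ^ (Q - 1)"
    by (subst power_image_iff) (simp_all only: dv, simp)
qed

lemma twist_nonzero:
  assumes "-1 = h ^ (Q - 1)"
  shows "(h::'a) \<noteq> 0"
proof
  assume "h = 0"
  have "(0::'a) ^ (Q - 1) = 0" using Q_ge_2 by (intro zero_power) simp
  with \<open>h = 0\<close> assms have "(-1::'a) = 0" by metis
  then show False by simp
qed

lemma W_minus: "W (- a) = W a"
proof -
  obtain c :: 'a where c: "-1 = c ^ (Q + 1)" using minus_1_power by blast
  then have c0: "c \<noteq> 0" by auto
  have "W (- a) = (\<Sum>x\<in>UNIV. \<psi> (a * (c * x) ^ (Q + 1)))"
    unfolding W_def power_mult_distrib c[symmetric] by simp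
  also have "\<dots> = W a" unfolding W_def
    by (rule sum.reindex_bij_witness[of _ "\<lambda>x. x / c" "\<lambda>x. c * x"]) (use c0 in auto)
  finally show ?thesis .
qed

text \<open>Expanding \<open>W (- a) * W a\<close> with \<open>y = x + u\<close> cancels the terms
  in \<open>x ^ (Q + 1)\<close> and leaves two cross terms, \<open>a * u * x ^ Q\<close> and
  \<open>a * u ^ Q * x\<close>. The second may be replaced by its \<open>Q\<close>-th power without
  changing \<open>\<psi>\<close>; then both are multiples of \<open>x ^ Q\<close>, and orthogonality
  restricts \<open>u\<close> to the kernel.\<close>

lemma W_square:
  "W a ^ 2 = of_nat CARD('a) * of_nat (card {u. a * u + a ^ Q * u ^ (Q * Q) = 0})"
proof -
  let ?K = "{u. a * u + a ^ Q * u ^ (Q * Q) = 0}"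
  have "W a ^ 2 = W (- a) * W a" by (simp add: W_minus power2_eq_square)
  also have "\<dots> = (\<Sum>x\<in>UNIV. \<Sum>y\<in>UNIV. \<psi> (- a * x ^ (Q + 1)) * \<psi> (a * y ^ (Q + 1)))"
    unfolding W_def by (rule sum_product)
  also have "\<dots> = (\<Sum>x\<in>UNIV. \<Sum>u\<in>UNIV. \<psi> (- a * x ^ (Q + 1)) * \<psi> (a * (x + u) ^ (Q + 1)))"
  proof (rule sum.cong[OF refl])
    fix x :: 'a
    show "(\<Sum>y\<in>UNIV. \<psi> (- a * x ^ (Q + 1)) * \<psi> (a * y ^ (Q + 1)))
        = (\<Sum>u\<in>UNIV. \<psi> (- a * x ^ (Q + 1)) * \<psi> (a * (x + u) ^ (Q + 1)))"
      by (rule sum.reindex_bij_witness[of _ "\<lambda>u. x + u" "\<lambda>y. y - x"]) auto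
  qed
  also have "\<dots> = (\<Sum>x\<in>UNIV. \<Sum>u\<in>UNIV. \<psi> (a * u ^ (Q + 1)) * \<psi> ((a * u + a ^ Q * u ^ (Q * Q)) * x ^ Q))"
  proof (intro sum.cong refl)
    fix x u
    have "\<psi> (- a * x ^ (Q + 1)) * \<psi> (a * (x + u) ^ (Q + 1))
        = \<psi> (- a * x ^ (Q + 1) + a * (x + u) ^ (Q + 1))" by (simp only: add)
    also have "- a * x ^ (Q + 1) + a * (x + u) ^ (Q + 1) = a * u ^ (Q + 1) + a * u * x ^ Q + a * u ^ Q * x"
      by (simp add: add_power_Q algebra_simps)
    also have "\<psi> \<dots> = \<psi> (a * u ^ (Q + 1)) * \<psi> (a * u * x ^ Q) * \<psi> ((a * u ^ Q * x) ^ Q)"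
      by (simp only: add frob_Q)
    also have "(a * u ^ Q * x) ^ Q = a ^ Q * u ^ (Q * Q) * x ^ Q"
      by (simp add: power_mult_distrib power_mult)
    finally show "\<psi> (- a * x ^ (Q + 1)) * \<psi> (a * (x + u) ^ (Q + 1))
        = \<psi> (a * u ^ (Q + 1)) * \<psi> ((a * u + a ^ Q * u ^ (Q * Q)) * x ^ Q)"
      by (simp only: distrib_right add mult.assoc)
  qed
  also have "\<dots> = (\<Sum>u\<in>UNIV. \<psi> (a * u ^ (Q + 1)) * (\<Sum>x\<in>UNIV. \<psi> ((a * u + a ^ Q * u ^ (Q * Q)) * x ^ Q)))"
    unfolding sum_distrib_left by (rule sum.swap)
  also have "\<dots> = (\<Sum>u\<in>UNIV. \<psi> (a * u ^ (Q + 1)) * (of_nat CARD('a) * of_bool (u \<in> ?K)))"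
    by (simp add: sum_power_Q[of "\<lambda>y. \<psi> (c * y)" for c] orthogonality)
  also have "\<dots> = (\<Sum>u\<in>UNIV. of_nat CARD('a) * of_bool (u \<in> ?K))"
  proof (intro sum.cong refl)
    fix u
    show "\<psi> (a * u ^ (Q + 1)) * (of_nat CARD('a) * of_bool (u \<in> ?K)) = of_nat CARD('a) * of_bool (u \<in> ?K)"
    \<comment> \<open>For \<open>u\<close> in the kernel, \<open>z = a * u ^ (Q + 1)\<close>
      satisfies \<open>z ^ Q = - z\<close>, the situation of \<open>antifixed\<close>; so all
      remaining terms are equal.\<close>
    proof (cases "u \<in> ?K")
      case True
      then have e: "a ^ Q * u ^ (Q * Q) = - (a * u)" by (simp add: eq_neg_iff_add_eq_0 add.commute)
      have "(a * u ^ (Q + 1)) ^ Q = (a ^ Q * u ^ (Q * Q)) * u ^ Q"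
        by (simp add: power_mult_distrib power_mult)
      also have "\<dots> = - (a * u ^ (Q + 1))" unfolding e by simp
      finally have "\<psi> (a * u ^ (Q + 1)) = 1"
        unfolding Q_def by (intro antifixed[of l]) (simp_all add: s_eq)
      then show ?thesis by simp
    qed simp
  qed
  also have "\<dots> = of_nat CARD('a) * of_nat (card ?K)"
    by (simp flip: sum_distrib_left)
  finally show ?thesis .
qed

text \<open>Because \<open>h ^ Q = - h\<close>, a nonzero \<open>u\<close> lies in the kernel iff
  \<open>(a * u ^ (Q + 1)) ^ (Q - 1) = 1\<close>. If \<open>a = c ^ (Q + 1)\<close>, then
  \<open>c * u\<close> runs over the roots of unity of order dividing \<open>Q ^ 2 - 1\<close>, all
  of which lie in the field. Conversely, raising the equation to the power \<open>E\<close> removes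
  \<open>u\<close> and leaves Euler's criterion for \<open>a\<close>.\<close>

lemma card_kernel:
  fixes h a :: 'a
  assumes h: "-1 = h ^ (Q - 1)" and a: "a \<noteq> 0"
  shows "card {u. h * a * u + (h * a) ^ Q * u ^ (Q * Q) = 0} = (if \<exists>x. a = x ^ (Q + 1) then Q ^ 2 else 1)"
proof -
  let ?K = "{u. h * a * u + (h * a) ^ Q * u ^ (Q * Q) = 0}"
  obtain E where E: "CARD('a) - 1 = (Q + 1) * (Q - 1) * E" "E > 0" by (rule units_factor)
  have h0: "h \<noteq> 0" using h by (rule twist_nonzero)
  have Q1: "Q = Suc (Q - 1)" "Q * Q = Suc ((Q + 1) * (Q - 1))" using Q_ge_2 by (auto simp: algebra_simps)
  have K: "?K = insert 0 {u. (a * u ^ (Q + 1)) ^ (Q - 1) = 1}"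
  proof -
    have "h * a * u + (h * a) ^ Q * u ^ (Q * Q) = h * a * u * (1 - (a * u ^ (Q + 1)) ^ (Q - 1))" for u
    proof -
      have "h ^ Q = - h" by (subst Q1(1)) (simp only: power_Suc flip: h, simp)
      moreover have "a ^ Q = a * a ^ (Q - 1)" by (subst Q1(1)) simp
      moreover have "u ^ (Q * Q) = u * (u ^ (Q + 1)) ^ (Q - 1)" by (subst Q1(2)) (simp only: power_Suc power_mult)
      ultimately show ?thesis by (simp add: power_mult_distrib algebra_simps)
    qed
    then show ?thesis using h0 a by auto
  qed
  have Q10: "Q - 1 \<noteq> 0" using Q_ge_2 by simp
  show ?thesis
  proof (cases "\<exists>x. a = x ^ (Q + 1)")
    case True
    then obtain c where c: "a = c ^ (Q + 1)" by blast
    have c0: "c \<noteq> 0" using c a by auto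
    have "{u. (a * u ^ (Q + 1)) ^ (Q - 1) = 1} = {u. (c * u) ^ ((Q + 1) * (Q - 1)) = 1}"
      unfolding c by (simp only: power_mult power_mult_distrib)
    moreover have "bij_betw (\<lambda>u. c * u) {u. (c * u) ^ ((Q + 1) * (Q - 1)) = 1} {u. u ^ ((Q + 1) * (Q - 1)) = 1}"
      by (rule bij_betw_byWitness[of _ "\<lambda>x. x / c"]) (use c0 in auto)
    ultimately have "card {u. (a * u ^ (Q + 1)) ^ (Q - 1) = 1} = card {u::'a. u ^ ((Q + 1) * (Q - 1)) = 1}"
      by (simp add: bij_betw_same_card)
    also have "\<dots> = gcd ((Q + 1) * (Q - 1)) (CARD('a) - 1)"
      using Q10 by (intro card_roots_of_one) simp
    also have "\<dots> = (Q + 1) * (Q - 1)" unfolding E(1) by (rule gcd_nat.absorb1) simp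
    finally have "card ?K = Suc ((Q + 1) * (Q - 1))"
      unfolding K using Q10 by (subst card_insert_disjoint) (auto simp: power_0_left)
    then show ?thesis using True Q1(2) by (simp add: power2_eq_square)
  next
    case False
    have "{u. (a * u ^ (Q + 1)) ^ (Q - 1) = 1} = {}"
    proof (intro equals0I, elim CollectE)
      fix u assume u: "(a * u ^ (Q + 1)) ^ (Q - 1) = 1"
      with Q10 have u0: "u \<noteq> 0" by (auto simp: power_0_left)
      have "(a * u ^ (Q + 1)) ^ ((Q - 1) * E) = 1" using u by (simp only: power_mult power_one)
      then have "a ^ ((Q - 1) * E) * u ^ (CARD('a) - 1) = 1"
        by (simp only: power_mult_distrib E(1) mult.assoc flip: power_mult)
      moreover have "(CARD('a) - 1) div (Q + 1) = (Q - 1) * E"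
        unfolding E(1) mult.assoc by (rule nonzero_mult_div_cancel_left) simp
      ultimately have "a ^ ((CARD('a) - 1) div (Q + 1)) = 1"
        using power_card_minus_1[OF u0] by simp
      moreover have "Q + 1 dvd CARD('a) - 1" unfolding E(1) mult.assoc by (rule dvd_triv_left)
      ultimately show False using False power_image_iff[of "Q + 1" a] a by simp
    qed
    then show ?thesis unfolding K using False by simp
  qed
qed

lemma Q_plus_1_dvd: "Q + 1 dvd CARD('a) - 1"
proof -
  obtain E where E: "CARD('a) - 1 = (Q + 1) * (Q - 1) * E" "E > 0" by (rule units_factor)
  show ?thesis unfolding E(1) mult.assoc by (rule dvd_triv_left)
qed

text \<open>An element \<open>z\<close> of the prime field has \<open>z ^ (p - 1) = 1\<close>, and
  \<open>p - 1\<close> divides \<open>(q - 1) / (Q + 1)\<close> through \<open>Q - 1\<close>. So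
  \<open>z\<close> is a \<open>(Q + 1)\<close>-th power and can be absorbed into
  \<open>x\<close>.\<close>

lemma W_prime_field:
  assumes "0 < i" "i < CHAR('a)"
  shows "W (of_nat i * a) = W a"
proof -
  obtain E where E: "CARD('a) - 1 = (Q + 1) * (Q - 1) * E" "E > 0" by (rule units_factor)
  define z where "z = (of_nat i :: 'a)"
  have z0: "z \<noteq> 0"
    using assms by (auto simp: z_def of_nat_eq_0_iff_char_dvd dest: dvd_imp_le)
  have "z ^ (CHAR('a) - 1) = 1"
  proof -
    have "CHAR('a) = Suc (CHAR('a) - 1)" using p_gt_1 by simp
    then have "z * z ^ (CHAR('a) - 1) = z ^ CHAR('a)" by (metis power_Suc)
    also have "\<dots> = z * 1" unfolding z_def by (simp add: of_nat_power_CHAR)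
    finally show ?thesis using z0 mult_cancel_left by blast
  qed
  moreover have "CHAR('a) - 1 dvd (CARD('a) - 1) div (Q + 1)"
  proof -
    have "(CARD('a) - 1) div (Q + 1) = (Q - 1) * E"
      unfolding E(1) mult.assoc by (rule nonzero_mult_div_cancel_left) simp
    then show ?thesis unfolding Q_def by (simp only:) (intro dvd_mult2 power_minus_1_dvd)
  qed
  ultimately have "z ^ ((CARD('a) - 1) div (Q + 1)) = 1" by (metis dvdE power_mult power_one)
  then obtain c where c: "z = c ^ (Q + 1)" using power_image_iff[OF Q_plus_1_dvd z0] by blast
  with z0 have c0: "c \<noteq> 0" by auto
  have "W (z * a) = (\<Sum>x\<in>UNIV. \<psi> (a * (c * x) ^ (Q + 1)))"
    unfolding W_def power_mult_distrib c by (simp only: mult_ac)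
  also have "\<dots> = W a" unfolding W_def
    by (rule sum.reindex_bij_witness[of _ "\<lambda>x. x / c" "\<lambda>x. c * x"]) (use c0 in auto)
  finally show ?thesis by (simp only: z_def)
qed

text \<open>
  Nonzero elements of the prime field are $(Q+1)$-th powers, so $\psi(a x^{Q+1})$ takes every
  nontrivial $p$-th root of unity equally often, namely \<open>N1\<close> times.
\<close>

lemma W_integer:
  obtains N1 :: nat where "W a = of_nat CARD('a) - of_nat CHAR('a) * of_nat N1" "Q + 1 dvd N1"
proof
  define \<zeta> where "\<zeta> = cis (2 * pi / real CHAR('a))"
  have z_pow: "\<zeta> ^ CHAR('a) = 1" using p_gt_1 by (simp add: \<zeta>_def Complex.DeMoivre)
  have z_1: "\<zeta> \<noteq> 1"
  proof
    assume "\<zeta> = 1"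
    then have "real 1 / real CHAR('a) \<in> \<int>" using cis_2pi_eq_1_iff[of "real 1 / real CHAR('a)"] by (simp add: \<zeta>_def)
    then have "CHAR('a) dvd 1" using p_gt_1 by (subst (asm) of_nat_div_in_Ints_iff) simp_all
    then show False using p_gt_1 by simp
  qed
  have z_sum: "(\<Sum>i<CHAR('a). 1 / \<zeta> ^ i) = 0"
  proof -
    have "(\<Sum>i<CHAR('a). 1 / \<zeta> ^ i) = (\<Sum>i<CHAR('a). (1 / \<zeta>) ^ i)" by (simp add: power_divide)
    also have "\<dots> = 0"
      using z_1 z_pow by (subst sum_gp_strict) (auto simp: power_divide)
    finally show ?thesis .
  qed
  define N1 where "N1 = card {x. \<psi> (a * x ^ (Q + 1)) = \<zeta>}"
  have split: "{..<CHAR('a)} = insert 0 {1..<CHAR('a)}" using p_gt_1 by auto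
  have "of_nat CHAR('a) * of_nat N1 = (\<Sum>x\<in>UNIV. of_nat CHAR('a) * of_bool (\<psi> (a * x ^ (Q + 1)) = \<zeta>))"
    by (simp add: N1_def flip: sum_distrib_left)
  also have "\<dots> = (\<Sum>x\<in>UNIV. \<Sum>i<CHAR('a). \<psi> (of_nat i * (a * x ^ (Q + 1))) / \<zeta> ^ i)"
    by (simp only: prime_field_sum[OF z_pow])
  also have "\<dots> = (\<Sum>i<CHAR('a). W (of_nat i * a) / \<zeta> ^ i)"
    unfolding W_def sum_divide_distrib mult.assoc by (rule sum.swap)
  \<comment> \<open>The index \<open>i = 0\<close> contributes the trivial sum \<open>q\<close>; the
    others all contain the same \<open>W a\<close>, whose coefficients
    \<open>1 / \<zeta> ^ i\<close> add up to -1.\<close>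
  also have "\<dots> = of_nat CARD('a) + (\<Sum>i\<in>{1..<CHAR('a)}. W a * (1 / \<zeta> ^ i))"
    unfolding split by (subst sum.insert) (auto simp: W_prime_field W_def[of 0] zero)
  also have "(\<Sum>i\<in>{1..<CHAR('a)}. W a * (1 / \<zeta> ^ i)) = - W a"
  proof -
    have "(\<Sum>i\<in>{1..<CHAR('a)}. 1 / \<zeta> ^ i) = -1"
      using z_sum unfolding split by (subst (asm) sum.insert) (auto simp: eq_neg_iff_add_eq_0 add.commute)
    then show ?thesis unfolding sum_distrib_left[symmetric] by simp
  qed
  finally show "W a = of_nat CARD('a) - of_nat CHAR('a) * of_nat N1" by simp
  \<comment> \<open>\<open>x = 0\<close> is not counted because \<open>\<zeta>\<close> is not 1, and
    the nonzero \<open>x\<close> come in fibres of \<open>x ^ (Q + 1)\<close>, each of size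
    \<open>Q + 1\<close>.\<close>
  have "N1 = (\<Sum>x\<in>UNIV. of_bool (\<psi> (a * x ^ (Q + 1)) = \<zeta>))" by (simp add: N1_def)
  also have "\<dots> = (\<Sum>x\<in>-{0}. of_bool (\<psi> (a * x ^ (Q + 1)) = \<zeta>))"
    by (rule sum.mono_neutral_right) (use z_1 zero in auto)
  also have "\<dots> = of_nat (gcd (Q + 1) (CARD('a) - 1))
      * (\<Sum>y\<in>(\<lambda>x. x ^ (Q + 1)) ` (-{0}). of_bool (\<psi> (a * y) = \<zeta>))"
    by (rule sum_over_powers) simp
  also have "gcd (Q + 1) (CARD('a) - 1) = Q + 1" using Q_plus_1_dvd by (rule gcd_nat.absorb1)
  finally show "Q + 1 dvd N1" unfolding of_nat_id by (metis dvd_triv_left)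
qed

lemma cong_Q_power: "[int Q ^ i = (-1) ^ i] (mod int Q + 1)"
  by (intro cong_pow) (simp add: cong_iff_dvd_diff)

text \<open>By the kernel size \<open>W (h * a)\<close> is \<open>Q ^ e\<close> up to sign, with
  \<open>e\<close> equal to \<open>\<gamma> + 1\<close> or \<open>\<gamma>\<close>. Modulo
  \<open>Q + 1\<close> it is 1 since \<open>q\<close> is 1 and \<open>N1\<close> is 0 there. As
  \<open>Q\<close> is -1 modulo \<open>Q + 1\<close>, the sign must be \<open>(-1) ^ e\<close>: the
  opposite one would make 1 and -1 congruent modulo a number greater than 2. The two cases merge
  because \<open>- Q = 1 - (Q + 1)\<close>.\<close>

lemma W_value:
  assumes h: "-1 = h ^ (Q - 1)" and a: "a \<noteq> 0"
  shows "W (h * a) = of_real (\<epsilon> * real Q ^ \<gamma> * (1 - real (Q + 1) * of_bool (\<exists>x. a = x ^ (Q + 1))))"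
proof -
  define e where "e = (if \<exists>x. a = x ^ (Q + 1) then \<gamma> + 1 else \<gamma>)"
  obtain N1 where N1: "W (h * a) = of_nat CARD('a) - of_nat CHAR('a) * of_nat N1" "Q + 1 dvd N1"
    by (rule W_integer)
  define w :: int where "w = int CARD('a) - int CHAR('a) * int N1"
  have w: "W (h * a) = of_int w" by (simp add: N1 w_def)
  have "complex_of_int (w ^ 2) = of_int ((int Q ^ e) ^ 2)"
    using W_square[of "h * a"] card_kernel[OF h a]
    by (simp add: w e_def q_eq power_mult_distrib flip: power_mult) (simp add: power_add mult.commute power2_eq_square)
  then have "w ^ 2 = (int Q ^ e) ^ 2" by (simp only: of_int_eq_iff)
  then have w2: "w = int Q ^ e \<or> w = - (int Q ^ e)" by (simp only: power2_eq_iff)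
  have cw: "[w = 1] (mod int Q + 1)"
  proof -
    have "[int CARD('a) = (-1) ^ (2 * \<gamma>)] (mod int Q + 1)"
      unfolding q_eq using cong_Q_power[of "2 * \<gamma>"] by simp
    moreover have "[int CHAR('a) * int N1 = 0] (mod int Q + 1)"
    proof -
      have "int Q + 1 dvd int N1" using N1(2) by (metis int_dvd_int_iff of_nat_1 of_nat_add)
      then show ?thesis by (simp add: cong_0_iff)
    qed
    ultimately have "[w = (-1) ^ (2 * \<gamma>) - 0] (mod int Q + 1)" unfolding w_def by (rule cong_diff)
    then show ?thesis by simp
  qed
  have "w = (-1) ^ e * int Q ^ e"
  proof (rule ccontr)
    assume "w \<noteq> (-1) ^ e * int Q ^ e"
    with w2 have "w = - ((-1) ^ e * int Q ^ e)" by (cases "even e") auto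
    moreover have "[- ((-1) ^ e * int Q ^ e) = - ((-1) ^ e * (-1) ^ e)] (mod int Q + 1)"
      using cong_Q_power[of e] by (intro cong_minus_minus_iff[THEN iffD2] cong_scalar_left)
    ultimately have "[w = -1] (mod int Q + 1)" by (simp flip: power_add mult_2)
    with cw have "[1 = -1] (mod int Q + 1)" by (metis cong_sym cong_trans)
    then have "int Q + 1 dvd 2" by (simp add: cong_iff_dvd_diff)
    then have "int Q + 1 \<le> 2" by (rule zdvd_imp_le) simp
    with Q_ge_2 show False by simp
  qed
  then show ?thesis unfolding w by (simp add: e_def \<epsilon>_def)
qed

text \<open>With \<open>Q + 1 = d * e\<close>, replacing \<open>y\<close> by
  \<open>x ^ e * y\<close> turns \<open>y ^ d\<close> into \<open>x ^ (Q + 1) * y ^ d\<close>.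
  Averaging over the units \<open>x\<close> therefore expresses the sum through the values
  \<open>W (h * (a * y ^ d))\<close>, and it remains to count the \<open>y\<close> for which
  \<open>a * y ^ d\<close> is a \<open>(Q + 1)\<close>-th power.\<close>

lemma power_sum_value:
  assumes h: "-1 = h ^ (Q - 1)" and a: "a \<noteq> 0" and d: "d dvd Q + 1"
  shows "(\<Sum>x\<in>UNIV. \<psi> (h * a * x ^ d)) = of_real (\<epsilon> * real Q ^ \<gamma> * (1 - real d * of_bool (\<exists>x. a = x ^ d)))"
proof -
  define N where "N = CARD('a) - 1"
  have N0: "N > 0" unfolding N_def by (rule card_units_pos)
  define c where "c = \<epsilon> * real Q ^ \<gamma>"
  define A where "A = {y\<in>-{0}. \<exists>x. a * y ^ d = x ^ (Q + 1)}"
  obtain e where e: "Q + 1 = d * e" using d by (elim dvdE)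
  then have d0: "d > 0" by (auto intro: Nat.gr0I)
  define G where "G = (\<Sum>x\<in>-{0}. \<psi> (h * a * x ^ d))"
  have e0: "e > 0" using e by (auto intro: Nat.gr0I)
  obtain E where E: "N = (Q + 1) * E" using Q_plus_1_dvd unfolding N_def by (elim dvdE)
  have E0: "E > 0" using E N0 by (auto intro: Nat.gr0I)
  have univ: "(UNIV::'a set) = insert 0 (-{0})" by auto
  have card_units: "card (-{0::'a}) = N"
    by (simp add: card_nonzero N_def)
  have "of_nat N * G = (\<Sum>x\<in>-{0::'a}. \<Sum>y\<in>-{0}. \<psi> (h * a * y ^ d))"
    unfolding G_def sum_constant card_units ..
  also have "\<dots> = (\<Sum>x\<in>-{0}. \<Sum>y\<in>-{0}. \<psi> (h * a * (x ^ e * y) ^ d))"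
    by (rule sum.cong[OF refl], rule sum_unit_translate[symmetric, of _ "\<lambda>y. \<psi> (h * a * y ^ d)"]) simp
  also have "\<dots> = (\<Sum>y\<in>-{0}. \<Sum>x\<in>-{0}. \<psi> (h * (a * y ^ d) * x ^ (Q + 1)))"
    unfolding e by (subst sum.swap) (simp only: power_mult_distrib mult_ac flip: power_mult)
  also have "\<dots> = (\<Sum>y\<in>-{0}. W (h * (a * y ^ d)) - 1)"
    unfolding W_def univ by (simp add: zero)
  also have "\<dots> = (\<Sum>y\<in>-{0}. of_real (c - 1 - c * real (Q + 1) * of_bool (y \<in> A)))"
  proof (rule sum.cong[OF refl])
    fix y assume y: "y \<in> -{0::'a}"
    then have "a * y ^ d \<noteq> 0" using a by simp
    from W_value[OF h this] y
    show "W (h * (a * y ^ d)) - 1 = of_real (c - 1 - c * real (Q + 1) * of_bool (y \<in> A))"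
      by (simp add: A_def c_def algebra_simps)
  qed
  also have "\<dots> = of_real (real N * (c - 1) - c * real (Q + 1) * real (card A))"
  proof -
    have "- {0} \<inter> {y. y \<in> A} = A" by (auto simp: A_def)
    then show ?thesis
      unfolding of_real_sum[symmetric] sum_subtractf sum_constant card_units
      by (simp add: card_units right_diff_distrib flip: sum_distrib_left)
  qed
  also have "card A = N div e * of_bool (\<exists>x. a = x ^ d)"
  proof (cases "\<exists>x. a = x ^ d")
    case True
    then obtain z where z: "a = z ^ d" by blast
    with a d0 have z0: "z \<noteq> 0" by auto
    \<comment> \<open>For \<open>a = z ^ d\<close> the condition on \<open>y\<close> is that
      \<open>(z * y) ^ d\<close> is a \<open>(Q + 1)\<close>-th power; by Euler's criterion
      \<open>z * y\<close> is then a root of unity of order dividing \<open>d * E\<close>, and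
      \<open>d * E = N div e\<close>.\<close>
    have "bij_betw (\<lambda>y. z * y) A {u. u ^ (d * E) = 1}"
    proof (rule bij_betw_byWitness[of _ "\<lambda>y. y / z"])
      have crit: "y \<in> A \<longleftrightarrow> (z * y) ^ (d * E) = 1" if "y \<noteq> 0" for y
      proof -
        have "y \<in> A \<longleftrightarrow> (\<exists>x. (z * y) ^ d = x ^ (Q + 1))" using that by (simp add: A_def z power_mult_distrib)
        also have "\<dots> \<longleftrightarrow> ((z * y) ^ d) ^ ((CARD('a) - 1) div (Q + 1)) = 1"
          by (rule power_image_iff[OF Q_plus_1_dvd]) (use z0 that in simp)
        also have "(CARD('a) - 1) div (Q + 1) = E" unfolding N_def[symmetric] E
          by (rule nonzero_mult_div_cancel_left) simp
        finally show ?thesis by (simp only: power_mult)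
      qed
      have A0: "y \<noteq> 0" if "y \<in> A" for y using that by (simp add: A_def)
      show "(\<lambda>y. z * y) ` A \<subseteq> {u. u ^ (d * E) = 1}" using crit A0 by auto
      have nz: "u \<noteq> 0" if "u ^ (d * E) = 1" for u :: 'a using that d0 E0 by (auto simp: power_0_left)
      show "(\<lambda>y. y / z) ` {u. u ^ (d * E) = 1} \<subseteq> A"
      proof
        fix y assume "y \<in> (\<lambda>y. y / z) ` {u. u ^ (d * E) = 1}"
        then obtain u where u: "y = u / z" "u ^ (d * E) = 1" by auto
        then show "y \<in> A" using crit[of y] nz[OF u(2)] z0 by simp
      qed
    qed (use z0 in auto)
    then have "card A = card {u::'a. u ^ (d * E) = 1}" by (rule bij_betw_same_card)
    also have "\<dots> = gcd (d * E) N" unfolding N_def using d0 E0 by (intro card_roots_of_one) simp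
    also have "\<dots> = d * E" unfolding E e by (rule gcd_nat.absorb1) (metis dvd_triv_left mult.assoc mult.commute)
    also have "\<dots> = N div e" using e0 unfolding E e by simp
    finally show ?thesis using True by simp
  next
    case False
    have "A = {}"
    proof (intro equals0I)
      fix y assume "y \<in> A"
      then obtain x where x: "y \<noteq> 0" "a * y ^ d = x ^ (Q + 1)" by (auto simp: A_def)
      have "(x ^ e / y) ^ d = x ^ (Q + 1) / y ^ d"
        by (simp only: e power_divide mult.commute[of d e] power_mult)
      also have "\<dots> = a" unfolding x(2)[symmetric] using x(1) by simp
      finally have "a = (x ^ e / y) ^ d" ..
      with False show False by blast
    qed
    with False show ?thesis by simp
  qed
  also have "real N * (c - 1) - c * real (Q + 1) * real (N div e * of_bool (\<exists>x. a = x ^ d))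
      = real N * (c - 1 - c * real d * of_bool (\<exists>x. a = x ^ d))"
  proof -
    have "N div e = d * E" using e0 unfolding E e by simp
    then have "real (Q + 1) * real (N div e) = real N * real d"
      unfolding E by (simp only: of_nat_mult mult_ac)
    then have "c * real (Q + 1) * real (N div e) = real N * (c * real d)"
      by (simp only: mult.assoc) (simp only: mult_ac)
    then show ?thesis by (cases "\<exists>x. a = x ^ d") (simp_all add: right_diff_distrib del: of_nat_Suc of_nat_add)
  qed
  finally have "G = of_real (c - 1 - c * real d * of_bool (\<exists>x. a = x ^ d))"
    using N0 by simp
  moreover have "(\<Sum>x\<in>UNIV. \<psi> (h * a * x ^ d)) = 1 + G"
    unfolding univ G_def using d0 by (simp add: zero power_0_left)
  ultimately show ?thesis unfolding c_def[symmetric] by (simp add: algebra_simps)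
qed

end

section \<open>Counting zeros of diagonal forms\<close>

lemma (in trace_character) sum_hom: "\<psi> (\<Sum>j\<in>J. f j) = (\<Prod>j\<in>J. \<psi> (f j))"
  by (induction J rule: infinite_finite_induct) (simp_all add: zero add)

text \<open>The range \<open>B\<close> is left open because the count is needed both for the whole
  field and for its units.\<close>

lemma (in trace_character) count_diagonal_zeros:
  assumes "finite J"
  shows "of_nat CARD('a) * of_nat (card {x \<in> PiE J (\<lambda>_. B). (\<Sum>j\<in>J. x j ^ m j) = 0})
    = (\<Sum>a\<in>UNIV. \<Prod>j\<in>J. \<Sum>x\<in>B. \<psi> (a * x ^ m j))"
proof -
  have fin: "finite (PiE J (\<lambda>_. B))" using assms by (intro finite_PiE) auto
  have "(\<Sum>a\<in>UNIV. \<Prod>j\<in>J. \<Sum>x\<in>B. \<psi> (a * x ^ m j))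
      = (\<Sum>a\<in>UNIV. \<Sum>x\<in>PiE J (\<lambda>_. B). \<psi> ((\<Sum>j\<in>J. x j ^ m j) * a))"
    using assms by (simp add: prod_sum_PiE sum_hom sum_distrib_left mult.commute[of _ "a::'a" for a])
  also have "\<dots> = (\<Sum>x\<in>PiE J (\<lambda>_. B). of_nat CARD('a) * of_bool ((\<Sum>j\<in>J. x j ^ m j) = 0))"
    by (subst sum.swap) (simp only: orthogonality)
  also have "\<dots> = of_nat CARD('a) * of_nat (card {x \<in> PiE J (\<lambda>_. B). (\<Sum>j\<in>J. x j ^ m j) = 0})"
    using fin by (simp add: Int_def flip: sum_distrib_left)
  finally show ?thesis ..
qed

context semiprimitive_character
begin

text \<open>A square root of \<open>q\<close> with sign \<open>(-1) ^ \<gamma>\<close>: the common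
  size of the twisted power sums. The powers \<open>c ^ r\<close> produce the factors
  \<open>q ^ (r / 2)\<close> and all signs of the final formula that depend on
  \<open>s\<close>.\<close>

definition c :: real where "c = \<epsilon> * real Q ^ \<gamma>"

lemma power_sum_gcd:
  assumes h: "-1 = h ^ (Q - 1)" and a: "a \<noteq> 0" and m: "m > 0" "d = gcd m (CARD('a) - 1)" "d dvd Q + 1"
  shows "(\<Sum>x\<in>UNIV. \<psi> (h * a * x ^ m)) = of_real (c * (1 - real d * of_bool (\<exists>x. a = x ^ d)))"
    and "(\<Sum>x\<in>-{0}. \<psi> (h * a * x ^ m)) = of_real (c * (1 - real d * of_bool (\<exists>x. a = x ^ d)) - 1)"
proof -
  have univ: "(UNIV::'a set) = insert 0 (-{0})" by auto
  have d0: "d > 0" using m by simp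
  have split: "(\<Sum>x\<in>UNIV. \<psi> (h * a * x ^ i)) = 1 + (\<Sum>x\<in>-{0}. \<psi> (h * a * x ^ i))" if "i > 0" for i
    unfolding univ using that by (simp add: zero power_0_left)
  have "(\<Sum>x\<in>-{0}. \<psi> (h * a * x ^ m)) = (\<Sum>x\<in>-{0}. \<psi> (h * a * x ^ d))"
    unfolding m(2) by (rule sum_over_powers_gcd[OF m(1)])
  with split[OF m(1)] split[OF d0] power_sum_value[OF h a m(3)]
  show "(\<Sum>x\<in>UNIV. \<psi> (h * a * x ^ m)) = of_real (c * (1 - real d * of_bool (\<exists>x. a = x ^ d)))"
    by (simp add: c_def)
  with split[OF m(1)]
  show "(\<Sum>x\<in>-{0}. \<psi> (h * a * x ^ m)) = of_real (c * (1 - real d * of_bool (\<exists>x. a = x ^ d)) - 1)"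
    by (simp add: algebra_simps)
qed

text \<open>The character with \<open>a = 0\<close> gives the main term. For the others each
  coordinate contributes \<open>- c * t a j\<close> over the whole field and
  \<open>- (c * t a j + 1)\<close> over the units. Multiplying out the latter gives a sum over
  subsets \<open>K\<close> of \<open>J\<close>, and \<open>sum_units_Icount\<close> evaluates each
  product of \<open>t a j\<close> summed over \<open>a\<close>.\<close>

lemma diagonal_zeros:
  fixes m d :: "nat \<Rightarrow> nat"
  assumes J: "finite J" and m: "\<And>j. j \<in> J \<Longrightarrow> m j > 0"
    and d: "\<And>j. j \<in> J \<Longrightarrow> d j = gcd (m j) (CARD('a) - 1)" "\<And>j. j \<in> J \<Longrightarrow> d j dvd Q + 1"
  shows "real CARD('a) * real (card {x \<in> PiE J (\<lambda>_. UNIV::'a set). (\<Sum>j\<in>J. x j ^ m j) = 0})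
      = real CARD('a) ^ card J + (- c) ^ card J * real (CARD('a) - 1) * real (Icount d J)"
    and "real CARD('a) * real (card {x \<in> PiE J (\<lambda>_. -{0::'a}). (\<Sum>j\<in>J. x j ^ m j) = 0})
      = real (CARD('a) - 1) ^ card J + (- 1) ^ card J * (\<Sum>K\<in>Pow J. c ^ card K * real (CARD('a) - 1) * real (Icount d K))"
proof -
  obtain h :: 'a where h: "-1 = h ^ (Q - 1)" using minus_1_power by blast
  have h0: "h \<noteq> 0" using h by (rule twist_nonzero)
  have univ: "(UNIV::'a set) = insert 0 (-{0})" by auto
  define t where "t a j = real (d j) * of_bool (\<exists>x. a = x ^ d j) - 1" for a :: 'a and j
  have vals: "(\<Sum>x\<in>UNIV. \<psi> (h * a * x ^ m j)) = complex_of_real (- c * t a j)"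
      "(\<Sum>x\<in>-{0}. \<psi> (h * a * x ^ m j)) = complex_of_real ((- 1) * (c * t a j + 1))"
    if a: "a \<in> -{0}" and j: "j \<in> J" for a j
  proof -
    have a0: "a \<noteq> 0" using a by simp
    show "(\<Sum>x\<in>UNIV. \<psi> (h * a * x ^ m j)) = complex_of_real (- c * t a j)"
      unfolding power_sum_gcd(1)[OF h a0 m[OF j] d(1)[OF j] d(2)[OF j]] of_real_eq_iff t_def
      by (simp add: algebra_simps)
    show "(\<Sum>x\<in>-{0}. \<psi> (h * a * x ^ m j)) = complex_of_real ((- 1) * (c * t a j + 1))"
      unfolding power_sum_gcd(2)[OF h a0 m[OF j] d(1)[OF j] d(2)[OF j]] of_real_eq_iff t_def
      by (simp add: algebra_simps)
  qed
  have Icount: "(\<Sum>a\<in>-{0}. \<Prod>j\<in>K. t a j) = real (CARD('a) - 1) * real (Icount d K)" if "K \<subseteq> J" for K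
    unfolding t_def using that J d(1) by (intro sum_units_Icount) (auto intro: finite_subset)
  \<comment> \<open>As \<open>a\<close> runs over all units, so does \<open>h * a\<close>; this is
    where the twist enters the count at no cost.\<close>
  have split: "(\<Sum>a\<in>UNIV. \<Prod>j\<in>J. \<Sum>x\<in>B. \<psi> (a * x ^ m j))
      = of_nat (card B) ^ card J + (\<Sum>a\<in>-{0}. \<Prod>j\<in>J. \<Sum>x\<in>B. \<psi> (h * a * x ^ m j))" for B
  proof -
    have "(\<Sum>a\<in>-{0}. \<Prod>j\<in>J. \<Sum>x\<in>B. \<psi> (h * a * x ^ m j)) = (\<Sum>a\<in>-{0}. \<Prod>j\<in>J. \<Sum>x\<in>B. \<psi> (a * x ^ m j))"
      by (rule sum_unit_translate[OF h0, of "\<lambda>a. \<Prod>j\<in>J. \<Sum>x\<in>B. \<psi> (a * x ^ m j)"])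
    then show ?thesis by (subst univ, subst sum.insert) (simp_all add: zero)
  qed
  have "of_nat CARD('a) * of_nat (card {x \<in> PiE J (\<lambda>_. UNIV::'a set). (\<Sum>j\<in>J. x j ^ m j) = 0})
      = of_nat CARD('a) ^ card J + (\<Sum>a\<in>-{0::'a}. \<Prod>j\<in>J. complex_of_real (- c * t a j))"
    unfolding count_diagonal_zeros[OF J] split
    by (simp only: vals(1) cong: sum.cong prod.cong)
  then have "complex_of_real (real CARD('a) * real (card {x \<in> PiE J (\<lambda>_. UNIV::'a set). (\<Sum>j\<in>J. x j ^ m j) = 0}))
      = of_real (real CARD('a) ^ card J + (\<Sum>a\<in>-{0::'a}. \<Prod>j\<in>J. - c * t a j))"
    by simp
  then show "real CARD('a) * real (card {x \<in> PiE J (\<lambda>_. UNIV::'a set). (\<Sum>j\<in>J. x j ^ m j) = 0})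
      = real CARD('a) ^ card J + (- c) ^ card J * real (CARD('a) - 1) * real (Icount d J)"
    unfolding of_real_eq_iff prod.distrib prod_constant sum_distrib_left[symmetric] Icount[OF order_refl]
    by (simp only: mult.assoc)
  have "of_nat CARD('a) * of_nat (card {x \<in> PiE J (\<lambda>_. -{0::'a}). (\<Sum>j\<in>J. x j ^ m j) = 0})
      = of_nat (CARD('a) - 1) ^ card J + (\<Sum>a\<in>-{0::'a}. \<Prod>j\<in>J. complex_of_real ((- 1) * (c * t a j + 1)))"
    unfolding count_diagonal_zeros[OF J] split card_nonzero
    by (simp only: vals(2) cong: sum.cong prod.cong)
  then have "complex_of_real (real CARD('a) * real (card {x \<in> PiE J (\<lambda>_. -{0::'a}). (\<Sum>j\<in>J. x j ^ m j) = 0}))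
      = of_real (real (CARD('a) - 1) ^ card J + (\<Sum>a\<in>-{0::'a}. \<Prod>j\<in>J. (- 1) * (c * t a j + 1)))"
    by simp
  then have *: "real CARD('a) * real (card {x \<in> PiE J (\<lambda>_. -{0::'a}). (\<Sum>j\<in>J. x j ^ m j) = 0})
      = real (CARD('a) - 1) ^ card J + (- 1) ^ card J * (\<Sum>a\<in>-{0::'a}. \<Prod>j\<in>J. c * t a j + 1)"
    unfolding of_real_eq_iff prod.distrib prod_constant sum_distrib_left[symmetric] .
  have "(\<Sum>a\<in>-{0::'a}. \<Prod>j\<in>J. c * t a j + 1) = (\<Sum>a\<in>-{0::'a}. \<Sum>K\<in>Pow J. c ^ card K * (\<Prod>j\<in>K. t a j))"
    using J by (simp add: prod_add prod.distrib)
  also have "\<dots> = (\<Sum>K\<in>Pow J. c ^ card K * (\<Sum>a\<in>-{0}. \<Prod>j\<in>K. t a j))"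
    by (subst sum.swap) (simp only: sum_distrib_left)
  also have "\<dots> = (\<Sum>K\<in>Pow J. c ^ card K * real (CARD('a) - 1) * real (Icount d K))"
    by (intro sum.cong refl) (simp only: Icount Pow_iff mult.assoc)
  finally show "real CARD('a) * real (card {x \<in> PiE J (\<lambda>_. -{0::'a}). (\<Sum>j\<in>J. x j ^ m j) = 0})
      = real (CARD('a) - 1) ^ card J + (- 1) ^ card J * (\<Sum>K\<in>Pow J. c ^ card K * real (CARD('a) - 1) * real (Icount d K))"
    using * by simp
qed

end

section \<open>Equidistribution over power residues\<close>

text \<open>By Bezout. It will be applied to the group of exponents by which \<open>\<Phi>\<close>
  can be rescaled, with \<open>X\<close> the list of numbers in the gcd hypothesis.\<close>

lemma Gcd_in_int_subgroup:
  fixes X Z :: "int set"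
  assumes fin: "finite X" and X: "X \<subseteq> Z" and zero: "0 \<in> Z"
    and add: "\<And>a b. a \<in> Z \<Longrightarrow> b \<in> Z \<Longrightarrow> a + b \<in> Z" and minus: "\<And>a. a \<in> Z \<Longrightarrow> - a \<in> Z"
  shows "Gcd X \<in> Z"
proof -
  have mult_nat: "int i * a \<in> Z" if "a \<in> Z" for i a
    by (induction i) (simp_all add: zero distrib_right add that)
  have mult: "i * a \<in> Z" if "a \<in> Z" for i a
    by (cases i rule: int_cases2) (use mult_nat[OF that] minus in auto)
  have gcd: "gcd a b \<in> Z" if "a \<in> Z" "b \<in> Z" for a b
  proof -
    obtain u v where "u * a + v * b = gcd a b" using bezout_int[of a b] by blast
    then show ?thesis using add[OF mult[OF that(1), of u] mult[OF that(2), of v]] by simp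
  qed
  show ?thesis using fin X by (induction X rule: finite_induct) (simp_all add: zero gcd)
qed

text \<open>The permutation belonging to \<open>t\<close> carries the fibre over 1 onto the fibre
  over \<open>t ^ k0\<close>. So \<open>S\<close> splits into equal fibres over the group of
  \<open>k0\<close>-th powers, which has \<open>(q - 1) / k0\<close> elements.\<close>

lemma equidistributed_fibres:
  fixes \<Phi> :: "'x \<Rightarrow> 'a::finite_field"
  assumes fin: "finite S" and k0: "k0 dvd CARD('a) - 1"
    and im: "\<And>x. x \<in> S \<Longrightarrow> \<exists>c. c \<noteq> 0 \<and> \<Phi> x = c ^ k0"
    and trans: "\<And>t. t \<noteq> 0 \<Longrightarrow> \<exists>\<tau>. bij_betw \<tau> S S \<and> (\<forall>x\<in>S. \<Phi> (\<tau> x) = t ^ k0 * \<Phi> x)"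
  shows "(CARD('a) - 1) * card {x\<in>S. \<Phi> x = 1} = k0 * card S"
proof -
  define H where "H = (\<lambda>t::'a. t ^ k0) ` (-{0})"
  have k00: "k0 > 0" using k0 card_units_pos[where ?'a='a] by (auto intro: Nat.gr0I)
  have "CARD('a) - 1 = k0 * card H"
  proof -
    have "gcd k0 (CARD('a) - 1) = k0" using k0 by (rule gcd_nat.absorb1)
    then show ?thesis
      using sum_over_powers[OF k00, of "\<lambda>_::'a. 1::nat"]
      by (simp add: H_def card_nonzero)
  qed
  moreover have "card {x\<in>S. \<Phi> x = y} = card {x\<in>S. \<Phi> x = 1}" if y: "y \<in> H" for y
  proof -
    obtain t where t: "t \<noteq> 0" "y = t ^ k0" using y by (auto simp: H_def)
    obtain \<tau> where \<tau>: "bij_betw \<tau> S S" "\<And>x. x \<in> S \<Longrightarrow> \<Phi> (\<tau> x) = y * \<Phi> x"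
      using trans[OF t(1)] t(2) by blast
    have "bij_betw \<tau> {x\<in>S. \<Phi> x = 1} {x\<in>S. \<Phi> x = y}"
      unfolding bij_betw_def
    proof
      show "inj_on \<tau> {x\<in>S. \<Phi> x = 1}" using \<tau>(1) by (auto simp: bij_betw_def intro: inj_on_subset)
      have "y \<noteq> 0" using t by simp
      show "\<tau> ` {x\<in>S. \<Phi> x = 1} = {x\<in>S. \<Phi> x = y}"
      proof (intro equalityI subsetI)
        fix z assume "z \<in> \<tau> ` {x\<in>S. \<Phi> x = 1}"
        then show "z \<in> {x\<in>S. \<Phi> x = y}" using \<tau> by (auto simp: bij_betw_def)
      next
        fix z assume z: "z \<in> {x\<in>S. \<Phi> x = y}"
        then have "z \<in> \<tau> ` S" using \<tau>(1) by (simp add: bij_betw_def)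
        then obtain x where x: "x \<in> S" "z = \<tau> x" by blast
        with z \<tau>(2)[OF x(1)] \<open>y \<noteq> 0\<close> have "\<Phi> x = 1" by simp
        with x show "z \<in> \<tau> ` {x\<in>S. \<Phi> x = 1}" by blast
      qed
    qed
    then show ?thesis by (rule bij_betw_same_card[symmetric])
  qed
  moreover have "card S = (\<Sum>y\<in>H. card {x\<in>S. \<Phi> x = y})"
  proof -
    have "\<Phi> x \<in> H" if "x \<in> S" for x using im[OF that] by (auto simp: H_def)
    then have "\<Phi> ` S \<subseteq> H" by blast
    from sum.group[OF fin _ this, of "\<lambda>_. 1::nat"] show ?thesis by (simp add: H_def)
  qed
  ultimately show ?thesis by simp
qed

text \<open>A solution without vanishing coordinates has nonzero right side, so its diagonal form is
  nonzero and it lies in the fibre \<open>\<Phi> x = 1\<close>. The work is to realise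
  multiplication of \<open>\<Phi>\<close> by every \<open>t ^ k0\<close> through a permutation of
  \<open>S\<close>.\<close>

lemma nonzero_solutions_count:
  fixes b c :: "'a::finite_field" and m kk d :: "nat \<Rightarrow> nat" and J :: "nat set"
  assumes J: "finite J" and k: "k > 0" and m: "\<And>j. j \<in> J \<Longrightarrow> m j > 0"
    and d: "\<And>j. j \<in> J \<Longrightarrow> d j = gcd (m j) (CARD('a) - 1)"
    and M: "\<And>j. j \<in> J \<Longrightarrow> m j dvd M"
    and k0: "k0 dvd k" "k0 dvd CARD('a) - 1" "\<And>j. j \<in> J \<Longrightarrow> k0 dvd kk j"
    and b: "b = c ^ k0" "b \<noteq> 0"
    and gcd1: "Gcd (insert (int (\<Sum>j\<in>J. kk j * M div (k0 * m j)) - int (k * M div k0))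
                 (insert (int ((CARD('a) - 1) div k0))
                   ((\<lambda>j. int (kk j * (CARD('a) - 1) div (k0 * d j))) ` J))) = 1"
  shows "(CARD('a) - 1) * card {x \<in> PiE J (\<lambda>_. -{0}). (\<Sum>j\<in>J. x j ^ m j) ^ k = b * (\<Prod>j\<in>J. x j ^ kk j)}
    = k0 * card {x \<in> PiE J (\<lambda>_. -{0::'a}). (\<Sum>j\<in>J. x j ^ m j) \<noteq> 0}"
proof -
  define S where "S = {x \<in> PiE J (\<lambda>_. -{0::'a}). (\<Sum>j\<in>J. x j ^ m j) \<noteq> 0}"
  define \<Phi> where "\<Phi> x = b * (\<Prod>j\<in>J. x j ^ kk j) / (\<Sum>j\<in>J. x j ^ m j) ^ k" for x
  have N0: "CARD('a) - 1 > 0" by (rule card_units_pos)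
  have k00: "k0 > 0" using k k0(1) by (auto intro: Nat.gr0I)
  have fin: "finite S" 
    unfolding S_def using J by (intro finite_subset[OF _ finite_PiE[of J "\<lambda>_. -{0::'a}"]]) auto
  have S0: "x j \<noteq> 0" if "x \<in> S" "j \<in> J" for x j using that by (auto simp: S_def PiE_iff)
  have im: "\<exists>c. c \<noteq> 0 \<and> \<Phi> x = c ^ k0" if x: "x \<in> S" for x
  proof -
    define y where "y = c * (\<Prod>j\<in>J. x j ^ (kk j div k0)) / (\<Sum>j\<in>J. x j ^ m j) ^ (k div k0)"
    have "(\<Prod>j\<in>J. x j ^ (kk j div k0)) ^ k0 = (\<Prod>j\<in>J. x j ^ kk j)"
      unfolding prod_power_distrib using k0(3) by (intro prod.cong) (auto simp flip: power_mult)
    moreover have "((\<Sum>j\<in>J. x j ^ m j) ^ (k div k0)) ^ k0 = (\<Sum>j\<in>J. x j ^ m j) ^ k"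
      using k0(1) by (simp flip: power_mult)
    ultimately have "\<Phi> x = y ^ k0"
      unfolding \<Phi>_def y_def power_divide power_mult_distrib by (simp add: b(1))
    moreover have "\<Phi> x \<noteq> 0"
      using x b(2) S0[OF x] J by (auto simp: \<Phi>_def S_def)
    ultimately show ?thesis using k00 by (intro exI[of _ y]) auto
  qed
  \<comment> \<open>\<open>A u\<close> says that \<open>u\<close> is an attainable multiplier of
    \<open>\<Phi>\<close>; the nonzero attainable multipliers form a group.\<close>
  define A where "A u \<longleftrightarrow> (\<exists>\<tau>. bij_betw \<tau> S S \<and> (\<forall>x\<in>S. \<Phi> (\<tau> x) = u * \<Phi> x))" for u
  have A1: "A 1" unfolding A_def by (intro exI[of _ id]) simp
  have A_mult: "A (u * v)" if "A u" "A v" for u v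
  proof -
    obtain \<sigma> where \<sigma>: "bij_betw \<sigma> S S" "\<And>x. x \<in> S \<Longrightarrow> \<Phi> (\<sigma> x) = u * \<Phi> x"
      using \<open>A u\<close> unfolding A_def by blast
    obtain \<tau> where \<tau>: "bij_betw \<tau> S S" "\<And>x. x \<in> S \<Longrightarrow> \<Phi> (\<tau> x) = v * \<Phi> x"
      using \<open>A v\<close> unfolding A_def by blast
    have "\<Phi> ((\<sigma> \<circ> \<tau>) x) = u * v * \<Phi> x" if "x \<in> S" for x
      using that \<sigma>(2) \<tau>(2) bij_betwE[OF \<tau>(1)] by (simp add: mult.assoc)
    with bij_betw_trans[OF \<tau>(1) \<sigma>(1)] show ?thesis unfolding A_def by blast
  qed
  have A_inverse: "A (inverse u)" if "A u" "u \<noteq> 0" for u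
  proof -
    obtain \<tau> where \<tau>: "bij_betw \<tau> S S" "\<And>x. x \<in> S \<Longrightarrow> \<Phi> (\<tau> x) = u * \<Phi> x"
      using \<open>A u\<close> unfolding A_def by blast
    have "\<Phi> (inv_into S \<tau> x) = inverse u * \<Phi> x" if x: "x \<in> S" for x
    proof -
      have "inv_into S \<tau> x \<in> S" "\<tau> (inv_into S \<tau> x) = x"
        using \<tau>(1) x by (auto simp: bij_betw_def inv_into_into f_inv_into_f)
      then show ?thesis using \<tau>(2)[of "inv_into S \<tau> x"] \<open>u \<noteq> 0\<close> by simp
    qed
    then show ?thesis unfolding A_def using bij_betw_inv_into[OF \<tau>(1)] by blast
  qed
  \<comment> \<open>Scaling coordinate \<open>j\<close> by \<open>w j\<close> preserves
    \<open>S\<close> provided all \<open>w j ^ m j\<close> have the same value \<open>r\<close>, by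
    which the diagonal form is then multiplied.\<close>
  have A_scale: "A ((\<Prod>j\<in>J. w j ^ kk j) / r ^ k)"
    if w: "\<And>j. j \<in> J \<Longrightarrow> w j \<noteq> 0" "\<And>j. j \<in> J \<Longrightarrow> w j ^ m j = r" and r: "r \<noteq> 0" for w r
  proof -
    define \<tau> where "\<tau> x = (\<lambda>j\<in>J. w j * x j)" for x :: "nat \<Rightarrow> 'a"
    have sum: "(\<Sum>j\<in>J. \<tau> x j ^ m j) = r * (\<Sum>j\<in>J. x j ^ m j)" for x
      unfolding sum_distrib_left \<tau>_def using w(2) by (intro sum.cong) (auto simp: power_mult_distrib)
    have prod: "(\<Prod>j\<in>J. \<tau> x j ^ kk j) = (\<Prod>j\<in>J. w j ^ kk j) * (\<Prod>j\<in>J. x j ^ kk j)" for x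
      unfolding prod.distrib[symmetric] \<tau>_def by (intro prod.cong) (auto simp: power_mult_distrib)
    have sub: "\<tau> ` S \<subseteq> S" using w r by (auto simp: S_def sum) (auto simp: \<tau>_def)
    have inj: "inj_on \<tau> S"
    proof (rule inj_onI)
      fix x y assume xy: "x \<in> S" "y \<in> S" "\<tau> x = \<tau> y"
      have "x j = y j" if j: "j \<in> J" for j
        using fun_cong[OF xy(3), of j] w(1)[OF j] j by (simp add: \<tau>_def)
      with xy show "x = y" by (intro PiE_ext[of x J _ y]) (auto simp: S_def)
    qed
    have "bij_betw \<tau> S S" using inj sub fin by (simp add: bij_betw_def endo_inj_surj)
    moreover have "\<Phi> (\<tau> x) = ((\<Prod>j\<in>J. w j ^ kk j) / r ^ k) * \<Phi> x" for x
      by (simp add: \<Phi>_def sum prod power_mult_distrib)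
    ultimately show ?thesis unfolding A_def by blast
  qed
  have "A (t ^ k0)" if t: "t \<noteq> 0" for t
  proof -
    \<comment> \<open>For fixed \<open>t\<close>, the exponents \<open>e\<close> with
      \<open>t ^ (k0 * e)\<close> attainable form a subgroup of the integers. Integer powers are
      needed since the first generator may be negative.\<close>
    define Z where "Z = {e::int. A (t powi (int k0 * e))}"
    have "Gcd (insert (int (\<Sum>j\<in>J. kk j * M div (k0 * m j)) - int (k * M div k0))
                 (insert (int ((CARD('a) - 1) div k0))
                   ((\<lambda>j. int (kk j * (CARD('a) - 1) div (k0 * d j))) ` J))) \<in> Z"
    proof (rule Gcd_in_int_subgroup)
      show "0 \<in> Z" by (simp add: Z_def A1)
      show "a + b \<in> Z" if "a \<in> Z" "b \<in> Z" for a b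
        using A_mult that t by (simp add: Z_def distrib_left power_int_add)
      show "- a \<in> Z" if "a \<in> Z" for a
        using A_inverse that t by (simp add: Z_def power_int_minus)
      \<comment> \<open>Weights \<open>w j = t ^ (M div m j)\<close> with \<open>r = t ^ M\<close>;
        the divisions are exact because \<open>k0\<close> divides \<open>kk j\<close> and
        \<open>k\<close>, and \<open>m j\<close> divides \<open>M\<close>.\<close>
      have "int (\<Sum>j\<in>J. kk j * M div (k0 * m j)) - int (k * M div k0) \<in> Z"
      proof -
        have "k0 * (kk j * M div (k0 * m j)) = M div m j * kk j" if j: "j \<in> J" for j
        proof -
          obtain e where e: "kk j = k0 * e" using k0(3)[OF j] by (elim dvdE)
          obtain f where f: "M = m j * f" using M[OF j] by (elim dvdE)
          have "kk j * M = (k0 * m j) * (e * f)" by (simp only: e f mult_ac)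
          then have "kk j * M div (k0 * m j) = e * f" using k00 m[OF j] by simp
          then show ?thesis using m[OF j] by (simp add: e f)
        qed
        then have "k0 * (\<Sum>j\<in>J. kk j * M div (k0 * m j)) = (\<Sum>j\<in>J. M div m j * kk j)"
          unfolding sum_distrib_left by (rule sum.cong[OF refl])
        moreover have "k0 * (k * M div k0) = M * k" using k0(1) by simp
        ultimately have e: "int k0 * (int (\<Sum>j\<in>J. kk j * M div (k0 * m j)) - int (k * M div k0))
            = int (\<Sum>j\<in>J. M div m j * kk j) - int (M * k)"
          unfolding right_diff_distrib by (simp only: of_nat_mult[symmetric])
        have "A ((\<Prod>j\<in>J. (t ^ (M div m j)) ^ kk j) / (t ^ M) ^ k)"
          by (rule A_scale) (use t M in \<open>auto simp flip: power_mult\<close>)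
        also have "(\<Prod>j\<in>J. (t ^ (M div m j)) ^ kk j) = t ^ (\<Sum>j\<in>J. M div m j * kk j)"
          unfolding power_sum by (simp only: power_mult)
        finally have "A (t ^ (\<Sum>j\<in>J. M div m j * kk j) / t ^ (M * k))" by (simp only: power_mult)
        moreover have "t powi (int a - int b) = t ^ a / t ^ b" for a b
          using t by (simp add: power_int_diff)
        ultimately show ?thesis by (simp only: Z_def mem_Collect_eq e)
      qed
      moreover have "int ((CARD('a) - 1) div k0) \<in> Z"
      proof -
        have "int k0 * int ((CARD('a) - 1) div k0) = int (CARD('a) - 1)"
          using k0(2) by (simp only: of_nat_mult[symmetric] dvd_mult_div_cancel)
        then show ?thesis
          using A1 by (simp only: Z_def mem_Collect_eq power_int_of_nat power_card_minus_1[OF t])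
      qed
      \<comment> \<open>Only coordinate \<open>i\<close> is scaled, by \<open>t ^ f\<close> with
        \<open>f = (q - 1) / d i\<close>. Its \<open>m i\<close>-th power is 1 because
        \<open>d i\<close> divides \<open>m i\<close>, so \<open>r = 1\<close>.\<close>
      moreover have "int (kk i * (CARD('a) - 1) div (k0 * d i)) \<in> Z" if i: "i \<in> J" for i
      proof -
        obtain e where e: "kk i = k0 * e" using k0(3)[OF i] by (elim dvdE)
        obtain f where f: "CARD('a) - 1 = d i * f" using d[OF i] by (metis dvd_def gcd_dvd2)
        obtain g where g: "m i = d i * g" using d[OF i] by (metis dvd_def gcd_dvd1)
        have di: "d i > 0" using d[OF i] m[OF i] by simp
        define w where "w j = (if j = i then t ^ f else 1)" for j
        have "kk i * (CARD('a) - 1) = (k0 * d i) * (e * f)" by (simp only: e f mult_ac)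
        then have "kk i * (CARD('a) - 1) div (k0 * d i) = e * f" using k00 di by simp
        then have ex: "int k0 * int (kk i * (CARD('a) - 1) div (k0 * d i)) = int (f * kk i)"
          by (simp add: e)
        have "(t ^ f) ^ m i = (t ^ (CARD('a) - 1)) ^ g"
          by (simp only: f g mult_ac flip: power_mult)
        then have wi: "(t ^ f) ^ m i = 1" using power_card_minus_1[OF t] by simp
        have "A ((\<Prod>j\<in>J. w j ^ kk j) / 1 ^ k)"
          by (rule A_scale) (use t wi in \<open>auto simp: w_def\<close>)
        also have "(\<Prod>j\<in>J. w j ^ kk j) = (\<Prod>j\<in>J. if j = i then t ^ (f * kk i) else 1)"
          by (intro prod.cong refl) (simp add: w_def power_mult)
        also have "\<dots> = t ^ (f * kk i)" using i J by simp
        finally show ?thesis by (simp only: Z_def mem_Collect_eq ex power_int_of_nat div_by_1 power_one)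
      qed
      ultimately show "insert (int (\<Sum>j\<in>J. kk j * M div (k0 * m j)) - int (k * M div k0))
                 (insert (int ((CARD('a) - 1) div k0))
                   ((\<lambda>j. int (kk j * (CARD('a) - 1) div (k0 * d j))) ` J)) \<subseteq> Z"
        unfolding insert_subset image_subset_iff by blast
    qed (use J in simp)
    then show ?thesis unfolding gcd1 by (simp add: Z_def)
  qed
  then have "(CARD('a) - 1) * card {x\<in>S. \<Phi> x = 1} = k0 * card S"
    unfolding A_def by (intro equidistributed_fibres fin k0(2) im) blast+
  moreover have "{x\<in>S. \<Phi> x = 1} = {x \<in> PiE J (\<lambda>_. -{0}). (\<Sum>j\<in>J. x j ^ m j) ^ k = b * (\<Prod>j\<in>J. x j ^ kk j)}"
  proof (intro equalityI subsetI)
    fix x assume "x \<in> {x\<in>S. \<Phi> x = 1}"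
    then show "x \<in> {x \<in> PiE J (\<lambda>_. -{0}). (\<Sum>j\<in>J. x j ^ m j) ^ k = b * (\<Prod>j\<in>J. x j ^ kk j)}"
      by (auto simp: S_def \<Phi>_def)
  next
    fix x assume x: "x \<in> {x \<in> PiE J (\<lambda>_. -{0}). (\<Sum>j\<in>J. x j ^ m j) ^ k = b * (\<Prod>j\<in>J. x j ^ kk j)}"
    then have "b * (\<Prod>j\<in>J. x j ^ kk j) \<noteq> 0" using b(2) J by (auto simp: PiE_iff)
    with x have "(\<Sum>j\<in>J. x j ^ m j) ^ k \<noteq> 0" by simp
    with k have "(\<Sum>j\<in>J. x j ^ m j) \<noteq> 0" by (auto simp: power_0_left)
    with x show "x \<in> {x\<in>S. \<Phi> x = 1}" by (simp add: S_def \<Phi>_def)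
  qed
  ultimately show ?thesis by (simp only: S_def)
qed

section \<open>The number of solutions\<close>

text \<open>Elimination of the auxiliary counts: \<open>Z1\<close> zeros of the diagonal form,
  \<open>Z0\<close> those without vanishing coordinates, \<open>Ns\<close> solutions without
  vanishing coordinates. It will be used with \<open>Y = q ^ (n - 1)\<close>,
  \<open>P = (q - 1) ^ n\<close>, \<open>e = (-1) ^ n\<close>, with \<open>C\<close> the
  contribution of the full set of coordinates and \<open>T\<close> that of the subsets of sizes 2 to
  \<open>n - 1\<close>.\<close>

lemma count_algebra:
  fixes q :: real
  assumes q: "q > 1" and Z1: "q * Z1 = q * Y + e * C * (q - 1)"
    and Z0: "q * Z0 = P + e * ((q - 1) * (1 + T + C))"
    and Ns: "(q - 1) * Ns = k0 * (P - Z0)" and N: "N + Z0 = Z1 + Ns"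
  shows "N = Y - e + (k0 - 1) * (P - e) / q - e * k0 * C / q - e * (k0 + q - 1) * T / q"
proof -
  have "(q - 1) * (q * N) = (q - 1) * (q * Z1) - (q - 1) * (q * Z0) + q * ((q - 1) * Ns)"
  proof -
    have "N = Z1 + Ns - Z0" using N by simp
    then show ?thesis unfolding \<open>N = _\<close> by (simp add: algebra_simps)
  qed
  also have "q * ((q - 1) * Ns) = k0 * (q * P - q * Z0)" unfolding Ns by (simp add: algebra_simps)
  also have "(q - 1) * (q * Z1) - (q - 1) * (q * Z0) + k0 * (q * P - q * Z0)
      = (q - 1) * (q * Y - q * e + (k0 - 1) * (P - e) - e * k0 * C - e * (k0 + q - 1) * T)"
    unfolding Z1 Z0 by (simp add: algebra_simps)
  finally have "q * N = q * Y - q * e + (k0 - 1) * (P - e) - e * k0 * C - e * (k0 + q - 1) * T"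
    using q by simp
  then have "N = (q * Y - q * e + (k0 - 1) * (P - e) - e * k0 * C - e * (k0 + q - 1) * T) / q"
    using q by (simp add: field_simps)
  then show ?thesis using q by (simp add: add_divide_distrib diff_divide_distrib)
qed

text \<open>Sizes 0, 1 and \<open>n\<close> are separated because the first two have trivial values
  of \<open>Icount\<close> (1 and 0), and the full set occurs in both counts of zeros and so gets a
  different coefficient.\<close>

lemma sum_Pow_by_card:
  fixes f :: "'b set \<Rightarrow> real"
  assumes "finite J" "card J = n" "n \<ge> 2"
  shows "(\<Sum>K\<in>Pow J. f K) = f {} + (\<Sum>j\<in>J. f {j})
    + (\<Sum>r=2..n-1. \<Sum>K\<in>{K. K \<subseteq> J \<and> card K = r}. f K) + f J"
proof -
  let ?g = "\<lambda>r. \<Sum>K\<in>{K. K \<subseteq> J \<and> card K = r}. f K"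
  have fin: "finite (Pow J)" using assms by simp
  have "card ` Pow J \<subseteq> {0..n}" using assms card_mono by fastforce
  from sum.group[OF fin _ this, of f]
  have "(\<Sum>K\<in>Pow J. f K) = (\<Sum>r\<in>{0..n}. ?g r)" by (simp add: Pow_def)
  also have "{0..n} = insert 0 (insert 1 (insert n {2..n-1}))" using assms by auto
  also have "(\<Sum>r\<in>\<dots>. ?g r) = ?g 0 + ?g 1 + (\<Sum>r=2..n-1. ?g r) + ?g n"
    using assms by (simp add: algebra_simps)
  also have "{K. K \<subseteq> J \<and> card K = 0} = {{}}" using assms finite_subset by fastforce
  also have "{K. K \<subseteq> J \<and> card K = 1} = (\<lambda>j. {j}) ` J" by (auto simp: card_1_singleton_iff)
  also have "{K. K \<subseteq> J \<and> card K = n} = {J}" 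
  proof -
    have "K = J" if "K \<subseteq> J" "card K = n" for K
      by (rule card_subset_eq[OF assms(1)]) (use that assms(2) in auto)
    then show ?thesis using assms(2) by auto
  qed
  finally show ?thesis by (simp add: sum.reindex)
qed

text \<open>Half-integral powers of \<open>q\<close> call for \<open>powr\<close>. All divisions of
  natural numbers in the statement are exact under its hypotheses, and
  \<open>s div (2 * l) - 1\<close> is not truncated since \<open>s > 0\<close>. The gcd is taken
  over the integers because its first entry may be negative.\<close>

theorem theorem4:
  fixes b :: "'a::finite_field"
    and p s q n k k0 D M l :: nat
    and kk m d :: "nat \<Rightarrow> nat"
    and Nq :: nat
  assumes p_def: "p = CHAR('a)"
    and q_def: "q = card (UNIV :: 'a set)"
    and q_ps: "q = p ^ s"
    and n2: "n \<ge> 2"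
    and b_nz: "b \<noteq> 0"
    and k_pos: "k > 0"
    and kk_pos: "\<forall>j\<in>{1..n}. kk j > 0"
    and m_pos: "\<forall>j\<in>{1..n}. m j > 0"
    and Nq_def: "Nq = card {x \<in> PiE {1..n} (\<lambda>_. UNIV).
                    (\<Sum>j=1..n. x j ^ m j) ^ k = b * (\<Prod>j=1..n. x j ^ kk j)}"
    and d_def: "\<forall>j\<in>{1..n}. d j = gcd (m j) (q - 1)"
    and D_def: "D = Lcm (d ` {1..n})"
    and M_def: "M = Lcm (m ` {1..n})"
    and k0_def: "k0 = Gcd (insert k (insert (q - 1) (kk ` {1..n})))"
    and b_pow: "\<exists>c. b = c ^ k0"
    and D2: "D > 2"
    and l_ex: "\<exists>l'>0. D dvd p ^ l' + 1"
    and l_def: "l = (LEAST l'. l' > 0 \<and> D dvd p ^ l' + 1)"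
    and gcd1: "Gcd (insert (int (\<Sum>j=1..n. kk j * M div (k0 * m j)) - int (k * M div k0))
                 (insert (int ((q - 1) div k0))
                   ((\<lambda>j. int (kk j * (q - 1) div (k0 * d j))) ` {1..n}))) = 1"
  shows "2 * l dvd s \<and>
    real Nq = real q ^ (n - 1) - (-1) ^ n
      + (real k0 - 1) * ((real q - 1) ^ n - (-1) ^ n) / real q
      - (-1) ^ ((s div (2 * l) - 1) * n) * real k0 * real q powr ((real n - 2) / 2)
          * real (Icount d {1..n})
      - (-1) ^ n * (real k0 + real q - 1) *
          (\<Sum>r=2..n-1. (-1) ^ (r * s div (2 * l)) * real q powr ((real r - 2) / 2)
             * (\<Sum>J\<in>{J. J \<subseteq> {1..n} \<and> card J = r}. real (Icount d J)))
    \<and> ((\<forall>j\<in>{1..n}. d j = D) \<longrightarrow>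
    real Nq = real q ^ (n - 1) - (-1) ^ n
      + (real k0 - 1) * ((real q - 1) ^ n - (-1) ^ n) / real q
      - (-1) ^ ((s div (2 * l) - 1) * n) * real k0 * real q powr ((real n - 2) / 2)
          * (((real D - 1) ^ n + (-1) ^ n * (real D - 1)) / real D)
      - (-1) ^ n * (real k0 + real q - 1) *
          (\<Sum>r=2..n-1. (-1) ^ (r * s div (2 * l)) * real q powr ((real r - 2) / 2)
             * real (n choose r) * (((real D - 1) ^ r + (-1) ^ r * (real D - 1)) / real D)))"
proof -
  let ?J = "{1..n}"
  define T where "T = (\<Sum>r=2..n-1. (-1) ^ (r * s div (2 * l)) * real q powr ((real r - 2) / 2)
             * (\<Sum>K\<in>{K. K \<subseteq> ?J \<and> card K = r}. real (Icount d K)))"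
  have d_dvd: "d j dvd q - 1" if "j \<in> ?J" for j using d_def that by simp
  have "D dvd q - 1" unfolding D_def using d_dvd by (intro Lcm_least) auto
  moreover have q_pos: "q - 1 > 0" unfolding q_def by (rule card_units_pos)
  ultimately have "[p ^ s = 1] (mod D)" unfolding q_ps by (simp add: cong_altdef_nat)
  note period = semiprimitive_period[OF D2 l_ex l_def this]
  define \<gamma> where "\<gamma> = s div (2 * l)"
  have s_eq: "s = 2 * l * \<gamma>" unfolding \<gamma>_def using period(3) by simp
  have card: "CARD('a) = CHAR('a) ^ s" using q_ps unfolding p_def q_def .
  then obtain \<psi> :: "'a \<Rightarrow> complex" where "trace_character \<psi> s"
    using trace_character_exists by blast
  then interpret trace_character \<psi> s .
  interpret semiprimitive_character \<psi> s l \<gamma> by unfold_locales (use period(1) s_eq in auto)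
  \<comment> \<open>\<open>R\<close> is the positive square root of \<open>q\<close>, and
    \<open>c\<close> is \<open>R\<close> up to sign; \<open>powr\<close>, \<open>sign\<close> and
    \<open>sign_n\<close> below rewrite the coefficients of the statement as powers of
    \<open>c\<close> divided by \<open>q\<close>.\<close>
  define R where "R = real Q ^ \<gamma>"
  have R0: "R > 0" unfolding R_def using Q_ge_2 by simp
  have q_R: "real q = R ^ 2" unfolding R_def q_def q_eq by (simp add: mult.commute flip: power_mult)
  have c_R: "c = (-1) ^ \<gamma> * R" by (simp add: c_def \<epsilon>_def R_def)
  have powr: "real q powr ((real r - 2) / 2) = R ^ r / real q" for r
  proof -
    have "real q powr ((real r - 2) / 2) = R powr (2 * ((real r - 2) / 2))"
      unfolding q_R using R0 by (simp only: powr_powr flip: powr_numeral)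
    also have "2 * ((real r - 2) / 2) = real r - real 2" by simp
    also have "R powr \<dots> = R ^ r / real q"
      unfolding q_R using R0 by (simp only: powr_diff powr_realpow)
    finally show ?thesis .
  qed
  have sign: "r * s div (2 * l) = \<gamma> * r" for r
  proof -
    have "r * s = (2 * l) * (\<gamma> * r)" unfolding s_eq by simp
    show ?thesis unfolding \<open>r * s = _\<close> by (rule nonzero_mult_div_cancel_left) (use period(1) in simp)
  qed
  have \<gamma>0: "\<gamma> > 0"
  proof (rule ccontr)
    assume "\<not> \<gamma> > 0"
    then have "s = 0" using s_eq by simp
    then show False using q_pos q_ps by simp
  qed
  \<comment> \<open>Lowering \<open>\<gamma>\<close> by 1 in the exponent accounts for the factor
    \<open>(-1) ^ n\<close>, which the terms with \<open>r < n\<close> carry explicitly.\<close>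
  have sign_n: "(-1::real) ^ ((s div (2 * l) - 1) * n) = (-1) ^ n * (-1) ^ (\<gamma> * n)"
  proof -
    have "\<gamma> * n = (\<gamma> - 1) * n + n" using \<gamma>0 by (cases \<gamma>) auto
    then show ?thesis by (simp add: \<gamma>_def[symmetric] power_add)
  qed
  have d_Q: "d j dvd Q + 1" if "j \<in> ?J" for j
  proof -
    have "d j dvd D" unfolding D_def using that by (intro dvd_Lcm) simp
    then show ?thesis using period(2) unfolding Q_def p_def by (rule dvd_trans)
  qed
  have d_gcd: "d j = gcd (m j) (CARD('a) - 1)" if "j \<in> ?J" for j
    using d_def that by (simp add: q_def)
  have d_pos: "d j > 0" if "j \<in> ?J" for j using d_def m_pos that by simp
  have m0: "m j > 0" if "j \<in> ?J" for j using m_pos that by simp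
  define Z1 where "Z1 = {x \<in> PiE ?J (\<lambda>_. UNIV::'a set). (\<Sum>j\<in>?J. x j ^ m j) = 0}"
  define Z0 where "Z0 = {x \<in> PiE ?J (\<lambda>_. -{0::'a}). (\<Sum>j\<in>?J. x j ^ m j) = 0}"
  define Ns where "Ns = {x \<in> PiE ?J (\<lambda>_. -{0::'a}). (\<Sum>j\<in>?J. x j ^ m j) ^ k = b * (\<Prod>j\<in>?J. x j ^ kk j)}"
  have fin: "finite {x \<in> PiE ?J (\<lambda>_. B). P x}" for B :: "'a set" and P
    by (rule finite_subset[of _ "PiE ?J (\<lambda>_. B)"]) (auto intro: finite_PiE)
  have main: "real Nq = real q ^ (n - 1) - (-1) ^ n
      + (real k0 - 1) * ((real q - 1) ^ n - (-1) ^ n) / real q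
      - (-1) ^ n * real k0 * (c ^ n * real (Icount d ?J)) / real q
      - (-1) ^ n * (real k0 + real q - 1) * (real q * T) / real q"
  proof (rule count_algebra)
    show "real q > 1" using q_pos by simp
    have n_Suc: "real q * real q ^ (n - 1) = real q ^ n" using n2 by (cases n) auto
    have q1: "real (q - 1) = real q - 1" using q_pos by (simp add: of_nat_diff)
    show "real q * real (card Z1) = real q * real q ^ (n - 1) + (-1) ^ n * (c ^ n * real (Icount d ?J)) * (real q - 1)"
      using diagonal_zeros(1)[of ?J m d] m0 d_gcd d_Q
      unfolding Z1_def[symmetric] q_def[symmetric] q1 n_Suc by (simp add: power_minus[of c] mult_ac)
    have Tsum: "(\<Sum>r=2..n-1. \<Sum>K\<in>{K. K \<subseteq> ?J \<and> card K = r}. c ^ card K * (real q - 1) * real (Icount d K))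
        = (real q - 1) * (real q * T)"
    proof -
      have coeff: "real q * ((-1) ^ (r * s div (2 * l)) * real q powr ((real r - 2) / 2) * X) = c ^ r * X" for r X
        unfolding powr sign c_R using q_pos by (simp add: power_mult_distrib power_mult)
      show ?thesis
        unfolding T_def sum_distrib_left coeff
        by (intro sum.cong refl) auto
    qed
    show "real q * real (card Z0) = (real q - 1) ^ n + (-1) ^ n * ((real q - 1) * (1 + real q * T + c ^ n * real (Icount d ?J)))"
    proof -
      have pow: "(\<Sum>K\<in>Pow ?J. c ^ card K * (real q - 1) * real (Icount d K))
          = (real q - 1) + (real q - 1) * (real q * T) + c ^ n * (real q - 1) * real (Icount d ?J)"
      proof -
        \<comment> \<open>A single fraction \<open>t / d\<close> with \<open>1 \<le> t < d\<close>
          is never an integer, which is why no term with \<open>r = 1\<close> survives.\<close>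
        have "(\<Sum>j\<in>?J. c ^ card {j} * (real q - 1) * real (Icount d {j})) = 0"
          by (intro sum.neutral ballI) (simp add: Icount_singleton d_pos del: One_nat_def)
        then show ?thesis
          using sum_Pow_by_card[of ?J n "\<lambda>K. c ^ card K * (real q - 1) * real (Icount d K)"] n2
          unfolding Tsum by (simp add: Icount_empty)
      qed
      have "real q * real (card Z0) = (real q - 1) ^ n
          + (-1) ^ n * (\<Sum>K\<in>Pow ?J. c ^ card K * (real q - 1) * real (Icount d K))"
        using diagonal_zeros(2)[of ?J m d] m0 d_gcd d_Q
        unfolding Z0_def[symmetric] q_def[symmetric] q1 by simp
      then show ?thesis unfolding pow by (simp add: algebra_simps)
    qed
    have Ns_eq: "(CARD('a) - 1) * card Ns = k0 * card {x \<in> PiE ?J (\<lambda>_. -{0::'a}). (\<Sum>j\<in>?J. x j ^ m j) \<noteq> 0}"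
    proof -
      obtain c where c: "b = c ^ k0" using b_pow by blast
      have k0: "k0 dvd y" if "y \<in> insert k (insert (q - 1) (kk ` ?J))" for y
        unfolding k0_def using that by (rule Gcd_dvd)
      show ?thesis unfolding Ns_def
        by (rule nonzero_solutions_count[where d=d and M=M and c=c])
           (use k_pos m0 d_gcd k0 c b_nz gcd1 in \<open>auto simp: M_def q_def intro: dvd_Lcm\<close>)
    qed
    have "card {x \<in> PiE ?J (\<lambda>_. -{0::'a}). (\<Sum>j\<in>?J. x j ^ m j) \<noteq> 0} + card Z0 = (CARD('a) - 1) ^ n"
    proof -
      have "card {x \<in> PiE ?J (\<lambda>_. -{0::'a}). (\<Sum>j\<in>?J. x j ^ m j) \<noteq> 0} + card Z0
          = card ({x \<in> PiE ?J (\<lambda>_. -{0::'a}). (\<Sum>j\<in>?J. x j ^ m j) \<noteq> 0} \<union> Z0)"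
        unfolding Z0_def by (rule card_Un_disjoint[symmetric, OF fin fin]) auto
      also have "{x \<in> PiE ?J (\<lambda>_. -{0::'a}). (\<Sum>j\<in>?J. x j ^ m j) \<noteq> 0} \<union> Z0 = PiE ?J (\<lambda>_. -{0})"
        by (auto simp: Z0_def)
      also have "card \<dots> = (CARD('a) - 1) ^ n"
        by (simp add: card_PiE card_nonzero)
      finally show ?thesis .
    qed
    then have "card {x \<in> PiE ?J (\<lambda>_. -{0::'a}). (\<Sum>j\<in>?J. x j ^ m j) \<noteq> 0}
        = real (CARD('a) - 1) ^ n - real (card Z0)"
      unfolding of_nat_power[symmetric] by linarith
    then have "real (CARD('a) - 1) * real (card Ns) = real k0 * (real (CARD('a) - 1) ^ n - real (card Z0))"
      using arg_cong[OF Ns_eq, of real] by (simp only: of_nat_mult)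
    then show "(real q - 1) * real (card Ns) = real k0 * ((real q - 1) ^ n - real (card Z0))"
      unfolding q_def[symmetric] q1 .
    \<comment> \<open>When some coordinate vanishes, so does the right side of the equation, and the
      solutions of this kind are exactly \<open>Z1 - Z0\<close>. The identity is stated additively
      to avoid subtraction of natural numbers.\<close>
    have "Nq + card Z0 = card Z1 + card Ns"
    proof -
      let ?X = "{x \<in> PiE ?J (\<lambda>_. UNIV::'a set). (\<Sum>j\<in>?J. x j ^ m j) ^ k = b * (\<Prod>j\<in>?J. x j ^ kk j)}"
      have sub: "PiE ?J (\<lambda>_. -{0::'a}) \<subseteq> PiE ?J (\<lambda>_. UNIV)" by (rule PiE_mono) simp
      have nz: "b * (\<Prod>j\<in>?J. x j ^ kk j) = 0 \<longleftrightarrow> x \<notin> PiE ?J (\<lambda>_. -{0})"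
        if "x \<in> PiE ?J (\<lambda>_. UNIV::'a set)" for x
        using that b_nz kk_pos by (auto simp: PiE_iff)
      have X: "?X = (Z1 - Z0) \<union> Ns"
      proof (intro equalityI subsetI)
        fix x assume x: "x \<in> ?X"
        show "x \<in> (Z1 - Z0) \<union> Ns"
        proof (cases "x \<in> PiE ?J (\<lambda>_. -{0})")
          case True
          with x show ?thesis by (simp add: Ns_def)
        next
          case False
          have xU: "x \<in> PiE ?J (\<lambda>_. UNIV)" and eq: "(\<Sum>j\<in>?J. x j ^ m j) ^ k = b * (\<Prod>j\<in>?J. x j ^ kk j)"
            using x by blast+
          have "(\<Sum>j\<in>?J. x j ^ m j) ^ k = 0" unfolding eq nz[OF xU] by (rule False)
          then have "(\<Sum>j\<in>?J. x j ^ m j) = 0" using power_eq_0_iff by blast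
          with xU False show ?thesis unfolding Z1_def Z0_def by blast
        qed
      next
        fix x assume x: "x \<in> (Z1 - Z0) \<union> Ns"
        show "x \<in> ?X"
        proof (cases "x \<in> Ns")
          case True
          with sub show ?thesis by (auto simp: Ns_def)
        next
          case False
          with x have xU: "x \<in> PiE ?J (\<lambda>_. UNIV)" and sum: "(\<Sum>j\<in>?J. x j ^ m j) = 0"
            and "x \<notin> PiE ?J (\<lambda>_. -{0})"
            unfolding Z1_def Z0_def by blast+
          then have "b * (\<Prod>j\<in>?J. x j ^ kk j) = 0" using nz[OF xU] by blast
          moreover have "(\<Sum>j\<in>?J. x j ^ m j) ^ k = 0" unfolding sum using k_pos by (rule zero_power)
          ultimately show ?thesis using xU by (simp only: mem_Collect_eq)
        qed
      qed
      have "Z0 \<subseteq> Z1" using sub by (auto simp: Z0_def Z1_def)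
      moreover have "finite Z1" "finite Ns" unfolding Z1_def Ns_def by (rule fin)+
      moreover have "(Z1 - Z0) \<inter> Ns = {}"
        using b_nz k_pos by (auto simp: Z1_def Z0_def Ns_def)
      ultimately have "card ?X = card Z1 - card Z0 + card Ns" "card Z0 \<le> card Z1"
        unfolding X by (auto simp: card_Un_disjoint card_Diff_subset finite_subset card_mono)
      then show ?thesis unfolding Nq_def by simp
    qed
    then show "real Nq + real (card Z0) = real (card Z1) + real (card Ns)" by (simp flip: of_nat_add)
  qed
  have cn: "(-1) ^ n * real k0 * (c ^ n * X) / real q
      = (-1) ^ ((s div (2 * l) - 1) * n) * real k0 * real q powr ((real n - 2) / 2) * X" for X
    unfolding sign_n powr c_R by (simp add: power_mult_distrib power_mult)
  have first: "real Nq = real q ^ (n - 1) - (-1) ^ n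
      + (real k0 - 1) * ((real q - 1) ^ n - (-1) ^ n) / real q
      - (-1) ^ ((s div (2 * l) - 1) * n) * real k0 * real q powr ((real n - 2) / 2)
          * real (Icount d ?J)
      - (-1) ^ n * (real k0 + real q - 1) * T"
    using main q_pos unfolding cn by simp
  have second: "real Nq = real q ^ (n - 1) - (-1) ^ n
      + (real k0 - 1) * ((real q - 1) ^ n - (-1) ^ n) / real q
      - (-1) ^ ((s div (2 * l) - 1) * n) * real k0 * real q powr ((real n - 2) / 2)
          * (((real D - 1) ^ n + (-1) ^ n * (real D - 1)) / real D)
      - (-1) ^ n * (real k0 + real q - 1) *
          (\<Sum>r=2..n-1. (-1) ^ (r * s div (2 * l)) * real q powr ((real r - 2) / 2)
             * real (n choose r) * (((real D - 1) ^ r + (-1) ^ r * (real D - 1)) / real D))"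
    if dD: "\<forall>j\<in>?J. d j = D"
  proof -
    have I: "real (Icount d K) = ((real D - 1) ^ card K + (-1) ^ card K * (real D - 1)) / real D"
      if "K \<subseteq> ?J" for K
      by (rule Icount_const) (use that dD D2 finite_subset in auto)
    have "(\<Sum>K\<in>{K. K \<subseteq> ?J \<and> card K = r}. real (Icount d K))
        = real (n choose r) * (((real D - 1) ^ r + (-1) ^ r * (real D - 1)) / real D)" for r
      by (simp add: I n_subsets)
    then have "T = (\<Sum>r=2..n-1. (-1) ^ (r * s div (2 * l)) * real q powr ((real r - 2) / 2)
             * real (n choose r) * (((real D - 1) ^ r + (-1) ^ r * (real D - 1)) / real D))"
      unfolding T_def by (simp only: mult.assoc)
    with first I[OF order_refl] show ?thesis by simp
  qed
  show ?thesis using period(3) first second unfolding T_def by blast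
qed

end
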